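(* Let $\mathcal H$ be a complex separable Hilbert space with orthonormal basis $\{e_l\}_{l\in\mathbb Z}$, let $I\subset\mathbb R$ be bounded, $p\in[1,\infty)$, and let $$T:\tilde{\mathcal B}_1^+\to L^2(I,\ell^p(\mathbb Z)),\qquad (T\rho)(\theta,l)=\langle e_l,U_\theta\rho U_\theta^*e_l\rangle,$$ where $U_\theta$, $\theta\in I$, are bounded linear operators on $\mathcal H$. If $\{U_\theta:\theta\in I\}$ is uniformly bounded in operator norm (in particular, if all $U_\theta$ are unitary), then $T$ is weak-$*$ to weak-$*$ sequentially continuous.
   Context: $\mathcal K$ denotes the compact operators on $\mathcal H$ and $\tilde{\mathcal B}_1^+$ the positive semidefinite trace-class operators. Weak-$*$ convergence $\rho_n\to\rho$ of trace-class operators means $\operatorname{tr}(\sigma\rho_n)\to\operatorname{tr}(\sigma\rho)$ for all $\sigma\in\mathcal K$. $\ell^p(\mathbb Z)$ are real sequence spaces. The weak-$*$-topology on $L^2(I,\ell^p(\mathbb Z))$ is the one induced by the predual $L^2(I,c_0(\mathbb Z))$ if $p=1$ and $L^2(I,\ell^{p'}(\mathbb Z))$, $\frac1p+\frac1{p'}=1$, if $p\in(1,\infty)$, via the pairing $\langle f,a\rangle=\int_I\sum_{l}f(\theta,l)a(\theta,l)\,d\theta$. It is implicit that $U_\theta$ depends on $\theta$ in such a way that $T$ maps into $L^2(I,\ell^p(\mathbb Z))$ (measurability in $\theta$). *)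

theory Defs
  imports "HOL-Analysis.Analysis"
begin

section \<open>Complex Hilbert spaces\<close>

text \<open>
  The underlying real Hilbert space carries the norm and the topology; since
  \<open>x \<bullet> y = Re (cinner x y)\<close>, the norm of \<open>x\<close> is the square root of \<open>cinner x x\<close>.
  The inner product is antilinear in its first argument.
\<close>

class chilbert_space = real_inner + complete_space +
  fixes scaleC :: "complex \<Rightarrow> 'a \<Rightarrow> 'a" (infixr \<open>*\<^sub>C\<close> 75)
    and cinner :: "'a \<Rightarrow> 'a \<Rightarrow> complex"
  assumes scaleC_add_right: "a *\<^sub>C (x + y) = a *\<^sub>C x + a *\<^sub>C y"
    and scaleC_add_left: "(a + b) *\<^sub>C x = a *\<^sub>C x + b *\<^sub>C x"
    and scaleC_scaleC: "a *\<^sub>C (b *\<^sub>C x) = (a * b) *\<^sub>C x"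
    and scaleC_complex_of_real: "complex_of_real r *\<^sub>C x = r *\<^sub>R x"
    and cinner_commute: "cinner x y = cnj (cinner y x)"
    and cinner_add_right: "cinner x (y + z) = cinner x y + cinner x z"
    and cinner_scaleC_right: "cinner x (a *\<^sub>C y) = a * cinner x y"
    and inner_eq_Re_cinner: "x \<bullet> y = Re (cinner x y)"

definition is_onb :: "('i \<Rightarrow> 'a::chilbert_space) \<Rightarrow> bool" where
  "is_onb e \<longleftrightarrow>
     (\<forall>k l. cinner (e k) (e l) = (if k = l then 1 else 0)) \<and>
     closure (module.span scaleC (range e)) = UNIV"

section \<open>Operators\<close>

definition bounded_clinear :: "('a::chilbert_space \<Rightarrow> 'a) \<Rightarrow> bool" where
  "bounded_clinear A \<longleftrightarrow> bounded_linear A \<and> (\<forall>c x. A (c *\<^sub>C x) = c *\<^sub>C A x)"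

definition cadjoint :: "('a::chilbert_space \<Rightarrow> 'a) \<Rightarrow> 'a \<Rightarrow> 'a" where
  "cadjoint A = (THE B. \<forall>x y. cinner (B x) y = cinner x (A y))"

definition unitary_op :: "('a::chilbert_space \<Rightarrow> 'a) \<Rightarrow> bool" where
  "unitary_op A \<longleftrightarrow> bounded_clinear A \<and> cadjoint A \<circ> A = id \<and> A \<circ> cadjoint A = id"

definition compact_op :: "('a::chilbert_space \<Rightarrow> 'a) \<Rightarrow> bool" where
  "compact_op A \<longleftrightarrow> bounded_clinear A \<and> compact (closure (A ` cball 0 1))"

definition positive_op :: "('a::chilbert_space \<Rightarrow> 'a) \<Rightarrow> bool" where
  "positive_op A \<longleftrightarrow> bounded_clinear A \<and> (\<forall>x. cinner x (A x) \<in> \<real>\<^sub>\<ge>\<^sub>0)"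

text \<open>\<open>abs_op A\<close> is the positive square root of \<open>A\<^sup>* A\<close>.\<close>

definition abs_op :: "('a::chilbert_space \<Rightarrow> 'a) \<Rightarrow> 'a \<Rightarrow> 'a" where
  "abs_op A = (THE B. positive_op B \<and> B \<circ> B = cadjoint A \<circ> A)"

text \<open>
  As usual, the trace and the trace class are defined by means of an orthonormal basis \<open>e\<close>;
  by the standard theory neither depends on its choice.
\<close>

definition trace_class :: "('i \<Rightarrow> 'a::chilbert_space) \<Rightarrow> ('a \<Rightarrow> 'a) \<Rightarrow> bool" where
  "trace_class e A \<longleftrightarrow>
     bounded_clinear A \<and> (\<lambda>l. cinner (e l) (abs_op A (e l))) summable_on UNIV"

definition op_trace :: "('i \<Rightarrow> 'a::chilbert_space) \<Rightarrow> ('a \<Rightarrow> 'a) \<Rightarrow> complex" where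
  "op_trace e A = (\<Sum>\<^sub>\<infinity>l. cinner (e l) (A (e l)))"

definition pos_trace_class :: "('i \<Rightarrow> 'a::chilbert_space) \<Rightarrow> ('a \<Rightarrow> 'a) set" where
  "pos_trace_class e = {\<rho>. positive_op \<rho> \<and> trace_class e \<rho>}"

definition weak_star_conv_op ::
    "('i \<Rightarrow> 'a::chilbert_space) \<Rightarrow> (nat \<Rightarrow> 'a \<Rightarrow> 'a) \<Rightarrow> ('a \<Rightarrow> 'a) \<Rightarrow> bool" where
  "weak_star_conv_op e \<rho>s \<rho> \<longleftrightarrow>
     (\<forall>\<sigma>. compact_op \<sigma> \<longrightarrow> (\<lambda>n. op_trace e (\<sigma> \<circ> \<rho>s n)) \<longlonglongrightarrow> op_trace e (\<sigma> \<circ> \<rho>))"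

section \<open>Sequence spaces and Bochner spaces\<close>

definition lp_space :: "real \<Rightarrow> (int \<Rightarrow> real) set" where
  "lp_space p = {a. (\<lambda>l. \<bar>a l\<bar> powr p) summable_on UNIV}"

definition lp_norm :: "real \<Rightarrow> (int \<Rightarrow> real) \<Rightarrow> real" where
  "lp_norm p a = (\<Sum>\<^sub>\<infinity>l. \<bar>a l\<bar> powr p) powr (1 / p)"

definition c0_space :: "(int \<Rightarrow> real) set" where
  "c0_space = {a. (a \<longlongrightarrow> 0) cofinite}"

definition sup_norm :: "(int \<Rightarrow> real) \<Rightarrow> real" where
  "sup_norm a = (SUP l. \<bar>a l\<bar>)"

text \<open>
  Bochner measurability and the Bochner space \<open>L\<^sup>2\<close> for functions with values in a space \<open>X\<close> of
  sequences that is normed by \<open>N\<close>. Elements of \<open>L\<^sup>2\<close> are represented by functions, which need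
  take values in \<open>X\<close> only almost everywhere.
\<close>

definition strongly_measurable ::
    "'t measure \<Rightarrow> (int \<Rightarrow> real) set \<Rightarrow> ((int \<Rightarrow> real) \<Rightarrow> real) \<Rightarrow> ('t \<Rightarrow> int \<Rightarrow> real) \<Rightarrow> bool"
where
  "strongly_measurable M X N f \<longleftrightarrow>
     (\<exists>s. (\<forall>n. simple_function M (s n) \<and> s n ` space M \<subseteq> X) \<and>
          (AE \<theta> in M. (\<lambda>n. N (\<lambda>l. s n \<theta> l - f \<theta> l)) \<longlonglongrightarrow> 0))"

definition L2_space ::
    "real set \<Rightarrow> (int \<Rightarrow> real) set \<Rightarrow> ((int \<Rightarrow> real) \<Rightarrow> real) \<Rightarrow> (real \<Rightarrow> int \<Rightarrow> real) set" where
  "L2_space I X N =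
     {f. (AE \<theta> in lebesgue_on I. f \<theta> \<in> X) \<and>
         strongly_measurable (lebesgue_on I) X N f \<and>
         integrable (lebesgue_on I) (\<lambda>\<theta>. (N (f \<theta>))\<^sup>2)}"

abbreviation L2_lp :: "real set \<Rightarrow> real \<Rightarrow> (real \<Rightarrow> int \<Rightarrow> real) set" where
  "L2_lp I p \<equiv> L2_space I (lp_space p) (lp_norm p)"

text \<open>The exponent \<open>p / (p - 1)\<close> is conjugate to \<open>p > 1\<close>.\<close>

definition L2_lp_predual :: "real set \<Rightarrow> real \<Rightarrow> (real \<Rightarrow> int \<Rightarrow> real) set" where
  "L2_lp_predual I p =
     (if p = 1 then L2_space I c0_space sup_norm else L2_lp I (p / (p - 1)))"

definition L2_pairing ::
    "real set \<Rightarrow> (real \<Rightarrow> int \<Rightarrow> real) \<Rightarrow> (real \<Rightarrow> int \<Rightarrow> real) \<Rightarrow> real" where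
  "L2_pairing I f a = (\<integral>\<theta>. (\<Sum>\<^sub>\<infinity>l. f \<theta> l * a \<theta> l) \<partial>lebesgue_on I)"

definition weak_star_conv_L2 ::
    "real set \<Rightarrow> real \<Rightarrow> (nat \<Rightarrow> real \<Rightarrow> int \<Rightarrow> real) \<Rightarrow> (real \<Rightarrow> int \<Rightarrow> real) \<Rightarrow> bool" where
  "weak_star_conv_L2 I p as a \<longleftrightarrow>
     (\<forall>f \<in> L2_lp_predual I p. (\<lambda>n. L2_pairing I f (as n)) \<longlonglongrightarrow> L2_pairing I f a)"

section \<open>The forward operator\<close>

text \<open>For positive \<open>\<rho>\<close> the inner product below is real, so that taking \<open>Re\<close> loses nothing.\<close>

definition forward_op ::
    "(int \<Rightarrow> 'a::chilbert_space) \<Rightarrow> (real \<Rightarrow> 'a \<Rightarrow> 'a) \<Rightarrow> ('a \<Rightarrow> 'a) \<Rightarrow> real \<Rightarrow> int \<Rightarrow> real" where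
  "forward_op e U \<rho> \<theta> l = Re (cinner (e l) ((U \<theta> \<circ> \<rho> \<circ> cadjoint (U \<theta>)) (e l)))"

definition weak_star_seq_continuous ::
    "(int \<Rightarrow> 'a::chilbert_space) \<Rightarrow> real set \<Rightarrow> real \<Rightarrow>
     (('a \<Rightarrow> 'a) \<Rightarrow> real \<Rightarrow> int \<Rightarrow> real) \<Rightarrow> bool" where
  "weak_star_seq_continuous e I p T \<longleftrightarrow>
     (\<forall>\<rho>s \<rho>. (\<forall>n. \<rho>s n \<in> pos_trace_class e) \<longrightarrow> \<rho> \<in> pos_trace_class e \<longrightarrow>
        weak_star_conv_op e \<rho>s \<rho> \<longrightarrow> weak_star_conv_L2 I p (\<lambda>n. T (\<rho>s n)) (T \<rho>))"

end

theory Submission imports Defs begin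

text \<open>
  Write \<open>q\<^sub>\<rho>(x) = \<langle>x, \<rho> x\<rangle>\<close>, so that \<open>(T \<rho>)(\<theta>, l) = q\<^sub>\<rho>(U\<^sub>\<theta>\<^sup>* e\<^sub>l)\<close>. Testing against rank one operators
  shows that weak-* convergence of \<open>\<rho>\<^sub>n\<close> implies pointwise convergence of \<open>q\<close> and hence of
  \<open>(T \<rho>\<^sub>n)(\<theta>, l)\<close>. The traces of the \<open>\<rho>\<^sub>n\<close> are bounded: otherwise there are finite sets \<open>F\<^sub>k\<close> of basis
  vectors on which some \<open>\<rho>\<^sub>n\<close> has partial trace larger than \<open>4\<^sup>k\<close>, and the compact operator
  \<open>\<Sum>\<^sub>k 2\<^sup>-\<^sup>k P(F\<^sub>k)\<close>, with \<open>P(F)\<close> the projection onto the span of \<open>F\<close>, has unbounded pairings with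
  the \<open>\<rho>\<^sub>n\<close>. Since \<open>tr (U \<rho> U\<^sup>*) \<le> \<parallel>U\<parallel>\<^sup>2 tr \<rho>\<close>, the sequences \<open>(T \<rho>\<^sub>n)(\<theta>, \<cdot>)\<close> are bounded in \<open>\<ell>\<^sup>1\<close>
  uniformly in \<open>n\<close> and \<open>\<theta>\<close>. Almost every value of a test function lies in \<open>c\<^sub>0\<close>, also for \<open>p > 1\<close>,
  so that the pairings converge pointwise in \<open>\<theta>\<close>, and dominated convergence concludes.
\<close>

section \<open>Complex Hilbert spaces\<close>

instance chilbert_space \<subseteq> banach ..

lemma scaleC_one [simp]: "1 *\<^sub>C (x :: 'a::chilbert_space) = x"
  using scaleC_complex_of_real[of 1 x] by simp

interpretation cvs: vector_space "scaleC :: complex \<Rightarrow> 'a::chilbert_space \<Rightarrow> 'a"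
  by unfold_locales (rule scaleC_add_right scaleC_add_left scaleC_scaleC scaleC_one)+

lemma cinner_add_left: "cinner (x + y) z = cinner x z + cinner y z"
  by (metis cinner_add_right cinner_commute complex_cnj_add)

lemma cinner_scaleC_left: "cinner (a *\<^sub>C x) y = cnj a * cinner x y"
  by (metis cinner_scaleC_right cinner_commute complex_cnj_mult)

lemma cinner_scaleR_right: "cinner x (r *\<^sub>R y) = r *\<^sub>R cinner x y"
  by (metis cinner_scaleC_right scaleC_complex_of_real scaleR_conv_of_real)

lemma cinner_scaleR_left: "cinner (r *\<^sub>R x) y = r *\<^sub>R cinner x y"
  by (metis cinner_scaleC_left scaleC_complex_of_real scaleR_conv_of_real complex_cnj_complex_of_real)

lemma cinner_self: "cinner x x = complex_of_real ((norm x)\<^sup>2)"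
proof -
  have "Im (cinner x x) = 0"
    using arg_cong[OF cinner_commute[of x x], of Im] by simp
  then show ?thesis
    by (simp add: complex_eq_iff power2_norm_eq_inner inner_eq_Re_cinner)
qed

lemma norm_scaleC: "norm (a *\<^sub>C x) = cmod a * norm x"
proof -
  have "complex_of_real ((norm (a *\<^sub>C x))\<^sup>2) = complex_of_real ((cmod a * norm x)\<^sup>2)"
    unfolding cinner_self[symmetric] cinner_scaleC_left cinner_scaleC_right
    by (simp add: cinner_self power_mult_distrib complex_norm_square mult.commute mult.left_commute flip: of_real_power)
  then show ?thesis
    by (metis of_real_eq_iff norm_ge_zero power2_eq_imp_eq mult_nonneg_nonneg)
qed

text \<open>A phase \<open>u\<close> applied to \<open>y\<close> turns the inner product with
  \<open>x\<close> into its modulus. That is then a real inner product, and the real Cauchy-Schwarz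
  inequality applies.\<close>

lemma norm_cinner_le: "cmod (cinner x y) \<le> norm x * norm y"
proof (cases "cinner x y = 0")
  case False
  define u where "u = cnj (cinner x y) / cmod (cinner x y)"
  have "cmod u = 1"
    using False by (simp add: u_def norm_divide)
  have "complex_of_real (cmod (cinner x y)) = cinner x (u *\<^sub>C y)"
    using False complex_norm_square[of "cinner x y"]
    by (simp add: cinner_scaleC_right u_def field_simps power2_eq_square)
  then have "cmod (cinner x y) = x \<bullet> (u *\<^sub>C y)"
    by (metis Re_complex_of_real inner_eq_Re_cinner)
  also have "\<dots> \<le> norm x * norm (u *\<^sub>C y)"
    by (rule norm_cauchy_schwarz)
  finally show ?thesis
    by (simp add: norm_scaleC \<open>cmod u = 1\<close>)
qed simp

lemma bounded_bilinear_cinner: "bounded_bilinear cinner"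
  by unfold_locales
    (auto simp: cinner_add_left cinner_add_right cinner_scaleR_left cinner_scaleR_right
          intro!: exI[of _ 1] norm_cinner_le)

lemma bounded_bilinear_scaleC: "bounded_bilinear scaleC"
proof
  fix r :: real and a :: complex and x :: 'a
  show "(r *\<^sub>R a) *\<^sub>C x = r *\<^sub>R (a *\<^sub>C x)"
    by (metis scaleC_complex_of_real scaleC_scaleC scaleR_conv_of_real)
  show "a *\<^sub>C (r *\<^sub>R x) = r *\<^sub>R (a *\<^sub>C x)"
    by (metis scaleC_complex_of_real scaleC_scaleC mult.commute)
qed (auto simp: scaleC_add_left scaleC_add_right norm_scaleC intro!: exI[of _ 1])

interpretation cinner: bounded_bilinear "cinner :: 'a::chilbert_space \<Rightarrow> 'a \<Rightarrow> complex"
  by (rule bounded_bilinear_cinner)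

interpretation scaleC: bounded_bilinear "scaleC :: complex \<Rightarrow> 'a::chilbert_space \<Rightarrow> 'a"
  by (rule bounded_bilinear_scaleC)

lemma cinner_eqI:
  assumes "\<And>y. cinner x y = cinner z y"
  shows "x = z"
proof -
  have "cinner (x - z) (x - z) = 0"
    using assms by (simp add: cinner.diff_left)
  then show ?thesis
    by (simp add: cinner_self)
qed

lemma bounded_clinear_imp_bounded_linear: "bounded_clinear A \<Longrightarrow> bounded_linear A"
  by (simp add: bounded_clinear_def)

lemma bounded_clinear_scaleC: "bounded_clinear A \<Longrightarrow> A (c *\<^sub>C x) = c *\<^sub>C A x"
  by (simp add: bounded_clinear_def)

section \<open>Positive operators: real quadratic form and self-adjointness\<close>

lemma positive_op_cinner: 
  assumes "positive_op A"
  shows "cinner x (A x) = complex_of_real (Re (cinner x (A x)))" "0 \<le> Re (cinner x (A x))"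
  using assms by (auto simp: positive_op_def complex_nonneg_Reals_iff complex_eq_iff)

text \<open>Polarization: since the quadratic form is real, its value at \<open>x + y\<close>
  controls the imaginary parts of the mixed terms, and its value at
  \<open>x + \<i> *\<^sub>C y\<close> controls their real parts.\<close>

lemma positive_op_selfadjoint:
  assumes "positive_op A"
  shows "cinner (A x) y = cinner x (A y)"
proof -
  have add: "A (u + v) = A u + A v" for u v
    using assms by (simp add: positive_op_def bounded_clinear_def linear_simps)
  have scale: "A (c *\<^sub>C u) = c *\<^sub>C A u" for c u
    using assms by (simp add: positive_op_def bounded_clinear_def)
  have im: "Im (cinner u (A u)) = 0" for u
    using positive_op_cinner(1)[OF assms, of u] by (metis Im_complex_of_real)
  have 1: "Im (cinner x (A y)) + Im (cinner y (A x)) = 0"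
    using im[of "x + y"] im[of x] im[of y] by (simp add: add cinner_add_left cinner_add_right)
  have 2: "Re (cinner x (A y)) - Re (cinner y (A x)) = 0"
    using im[of "x + \<i> *\<^sub>C y"] im[of x] im[of y]
    by (simp add: add scale cinner_add_left cinner_add_right cinner_scaleC_left cinner_scaleC_right)
  show ?thesis
    using 1 2 cinner_commute[of "A x" y] by (simp add: complex_eq_iff)
qed

section \<open>Orthonormal bases and adjoints\<close>

text \<open>By Pythagoras the finite partial sums form a Cauchy net as soon as the sums of squared
  norms do, and the space is complete.\<close>

lemma summable_on_orthogonal:
  fixes f :: "'i \<Rightarrow> 'a::chilbert_space"
  assumes orth: "\<And>i j. i \<in> A \<Longrightarrow> j \<in> A \<Longrightarrow> i \<noteq> j \<Longrightarrow> f i \<bullet> f j = 0"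
    and sq: "(\<lambda>i. (norm (f i))\<^sup>2) summable_on A"
  shows "f summable_on A"
proof -
  let ?g = "\<lambda>i. (norm (f i))\<^sup>2"
  have pyth: "(norm (sum f F))\<^sup>2 = sum ?g F" if "finite F" "F \<subseteq> A" for F
    using that by (intro norm_sum_Pythagorean)
      (auto simp: pairwise_def orthogonal_def orth subset_iff)
  have "\<exists>P. eventually P (finite_subsets_at_top A) \<and>
          (\<forall>F G. P F \<and> P G \<longrightarrow> dist (sum f F) (sum f G) < \<epsilon>)" if "\<epsilon> > 0" for \<epsilon>
  proof (intro exI conjI allI impI)
    \<comment> \<open>Once \<open>F\<close> captures the total of squares up to
      \<open>(\<epsilon>/2)\<^sup>2\<close>, enlarging it moves the vector sum by less than
      \<open>\<epsilon>/2\<close>. Two such sets are then compared through their union.\<close>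
    let ?P = "\<lambda>F. finite F \<and> F \<subseteq> A \<and> infsum ?g A - (\<epsilon>/2)\<^sup>2 < sum ?g F"
    have "(sum ?g \<longlongrightarrow> infsum ?g A) (finite_subsets_at_top A)"
      using infsum_tendsto[OF sq] .
    from order_tendstoD(1)[OF this, of "infsum ?g A - (\<epsilon>/2)\<^sup>2"]
    have "\<forall>\<^sub>F F in finite_subsets_at_top A. infsum ?g A - (\<epsilon>/2)\<^sup>2 < sum ?g F"
      using \<open>\<epsilon> > 0\<close> by simp
    moreover have "\<forall>\<^sub>F F in finite_subsets_at_top A. finite F \<and> F \<subseteq> A"
      by (intro eventually_finite_subsets_at_top_weakI) auto
    ultimately show "eventually ?P (finite_subsets_at_top A)"
      by eventually_elim auto
    fix F G assume FG: "?P F \<and> ?P G"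
    have near: "dist (sum f H) (sum f (F \<union> G)) < \<epsilon>/2" if "H \<subseteq> F \<union> G" "?P H" for H
    proof (rule power_less_imp_less_base)
      have "(dist (sum f H) (sum f (F \<union> G)))\<^sup>2 = (norm (sum f (F \<union> G - H)))\<^sup>2"
        using FG that by (subst sum_diff) (auto simp: dist_norm norm_minus_commute)
      also have "\<dots> = sum ?g (F \<union> G) - sum ?g H"
        using FG that by (subst pyth) (auto simp: sum_diff)
      also have "sum ?g (F \<union> G) \<le> infsum ?g A"
        using FG by (intro finite_sum_le_infsum sq) auto
      finally show "(dist (sum f H) (sum f (F \<union> G)))\<^sup>2 < (\<epsilon>/2)\<^sup>2"
        using that by simp
    qed (use \<open>\<epsilon> > 0\<close> in simp)
    have "dist (sum f F) (sum f G)
        \<le> dist (sum f F) (sum f (F \<union> G)) + dist (sum f G) (sum f (F \<union> G))"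
      by (rule dist_triangle2)
    then show "dist (sum f F) (sum f G) < \<epsilon>"
      using near[of F] near[of G] FG by auto
  qed
  then have "cauchy_filter (filtermap (sum f) (finite_subsets_at_top A))"
    by (simp add: cauchy_filter_metric_filtermap)
  moreover have "complete (UNIV :: 'a set)"
    by (meson Cauchy_convergent UNIV_I complete_def convergent_def)
  moreover have "filtermap (sum f) (finite_subsets_at_top A) \<noteq> bot"
    by (simp add: filtermap_bot_iff)
  ultimately obtain L where "(sum f \<longlongrightarrow> L) (finite_subsets_at_top A)"
    using cauchy_filter_complete_converges[of "filtermap (sum f) (finite_subsets_at_top A)" UNIV]
    by (auto simp: filterlim_def)
  then show ?thesis
    by (auto simp: summable_on_def has_sum_def)
qed

lemma cinner_mult_cinner: "cinner x y * cinner y x = complex_of_real ((cmod (cinner y x))\<^sup>2)"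
  using complex_norm_square[of "cinner y x"] cinner_commute[of x y] by (simp add: mult.commute)

section \<open>Finite basis projections, Bessel, Parseval and the existence of adjoints\<close>

locale orthonormal_basis =
  fixes e :: "'i \<Rightarrow> 'a::chilbert_space"
  assumes onb: "is_onb e"
begin

lemma cinner_basis: "cinner (e k) (e l) = (if k = l then 1 else 0)"
  using onb by (simp add: is_onb_def)

lemma norm_basis [simp]: "norm (e l) = 1"
proof -
  have "complex_of_real ((norm (e l))\<^sup>2) = complex_of_real 1"
    unfolding cinner_self[symmetric] by (simp add: cinner_basis)
  then have "(norm (e l))\<^sup>2 = 1"
    by (simp only: of_real_eq_iff)
  then show ?thesis
    using norm_ge_zero[of "e l"] by (simp add: power2_eq_1_iff)
qed

text \<open>For finite \<open>G\<close> this is the orthogonal projection onto the span of the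
  \<open>e l\<close> with \<open>l \<in> G\<close>.\<close>

definition proj :: "'i set \<Rightarrow> 'a \<Rightarrow> 'a" where
  "proj G x = (\<Sum>l\<in>G. cinner (e l) x *\<^sub>C e l)"

lemma proj_add: "proj G (x + y) = proj G x + proj G y"
  by (simp add: proj_def cinner.add_right scaleC_add_left sum.distrib)

lemma proj_diff: "proj G (x - y) = proj G x - proj G y"
  by (simp add: proj_def cinner.diff_right scaleC.diff_left sum_subtractf)

lemma proj_scaleC: "proj G (c *\<^sub>C x) = c *\<^sub>C proj G x"
  by (simp add: proj_def cinner_scaleC_right scaleC_scaleC scaleC.sum_right)

lemma cinner_proj_left: "finite G \<Longrightarrow> cinner (proj G x) y = (\<Sum>l\<in>G. cinner x (e l) * cinner (e l) y)"
  by (simp add: proj_def cinner.sum_left cinner_scaleC_left flip: cinner_commute)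

lemma cinner_proj_right: "finite G \<Longrightarrow> cinner x (proj G y) = (\<Sum>l\<in>G. cinner x (e l) * cinner (e l) y)"
  by (simp add: proj_def cinner.sum_right cinner_scaleC_right mult.commute)

lemma cinner_basis_proj: "finite G \<Longrightarrow> cinner (e k) (proj G x) = (if k \<in> G then cinner (e k) x else 0)"
  by (simp add: cinner_proj_right cinner_basis if_distrib[of "\<lambda>c. c * _"] sum.delta cong: if_cong)

lemma proj_basis: "finite G \<Longrightarrow> l \<in> G \<Longrightarrow> proj G (e l) = e l"
  by (simp add: proj_def cinner_basis if_distrib[of "\<lambda>c. c *\<^sub>C _"] sum.delta cong: if_cong)

lemma cinner_proj_proj: "finite G \<Longrightarrow> cinner (proj G x) (proj G y) = cinner x (proj G y)"
  by (simp add: cinner_proj_left[of G x] cinner_proj_right[of G x] cinner_basis_proj)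

lemma norm_proj_sq: "finite G \<Longrightarrow> (norm (proj G x))\<^sup>2 = (\<Sum>l\<in>G. (cmod (cinner (e l) x))\<^sup>2)"
proof -
  assume "finite G"
  then have "complex_of_real ((norm (proj G x))\<^sup>2) = complex_of_real (\<Sum>l\<in>G. (cmod (cinner (e l) x))\<^sup>2)"
    unfolding cinner_self[symmetric] cinner_proj_proj[OF \<open>finite G\<close>]
    unfolding cinner_proj_right[OF \<open>finite G\<close>] cinner_mult_cinner of_real_sum by simp
  then show ?thesis
    by (simp only: of_real_eq_iff)
qed

lemma Pythagoras_proj: "finite G \<Longrightarrow> (norm x)\<^sup>2 = (norm (proj G x))\<^sup>2 + (norm (x - proj G x))\<^sup>2"
proof -
  assume G: "finite G"
  have "cinner (proj G x) (x - proj G x) = 0"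
    using G by (simp add: cinner.diff_right cinner_proj_proj) (simp add: cinner_proj_left cinner_proj_right)
  then have "proj G x \<bullet> (x - proj G x) = 0"
    by (simp add: inner_eq_Re_cinner)
  then show ?thesis
    using norm_add_Pythagorean[of "proj G x" "x - proj G x"] by (simp add: orthogonal_def)
qed

lemma norm_proj_le: "finite G \<Longrightarrow> norm (proj G x) \<le> norm x"
  by (rule power2_le_imp_le) (simp_all add: Pythagoras_proj[of G x])

lemma norm_diff_proj_le: "finite G \<Longrightarrow> norm (x - proj G x) \<le> norm x"
  by (rule power2_le_imp_le) (simp_all add: Pythagoras_proj[of G x])

lemma Bessel: "finite G \<Longrightarrow> (\<Sum>l\<in>G. (cmod (cinner (e l) x))\<^sup>2) \<le> (norm x)\<^sup>2"
  using power_mono[OF norm_proj_le[of G x] norm_ge_zero, of 2] by (simp add: norm_proj_sq)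

text \<open>A vector in the span involves finitely many basis vectors, and every finite
  \<open>G\<close> containing their indices leaves it fixed.\<close>

lemma proj_span:
  assumes "x \<in> module.span scaleC (range e)"
  shows "\<exists>F. finite F \<and> (\<forall>G. finite G \<longrightarrow> F \<subseteq> G \<longrightarrow> proj G x = x)"
  using assms
proof (induction rule: cvs.span_induct_alt)
  case base
  show ?case by (auto simp: proj_def cinner.zero_right intro: exI[of _ "{}"])
next
  case (step c x y)
  then obtain l F where "x = e l" "finite F" "\<And>G. finite G \<Longrightarrow> F \<subseteq> G \<Longrightarrow> proj G y = y"
    by auto
  then show ?case
    by (intro exI[of _ "insert l F"]) (simp add: proj_add proj_scaleC proj_basis)
qed

text \<open>On the dense span the projections are eventually exact. The error operator is a
  contraction for every finite \<open>G\<close>, so the convergence extends to the closure.\<close>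

lemma tendsto_proj: "((\<lambda>G. proj G x) \<longlongrightarrow> x) (finite_subsets_at_top UNIV)"
proof (rule tendstoI)
  fix \<epsilon> :: real assume "\<epsilon> > 0"
  have "x \<in> closure (module.span scaleC (range e))"
    using onb by (simp add: is_onb_def)
  then obtain y where y: "y \<in> module.span scaleC (range e)" "dist y x < \<epsilon>"
    using \<open>\<epsilon> > 0\<close> by (meson closure_approachable)
  obtain F where F: "finite F" "\<And>G. finite G \<Longrightarrow> F \<subseteq> G \<Longrightarrow> proj G y = y"
    using proj_span[OF y(1)] by blast
  have "dist (proj G x) x < \<epsilon>" if "finite G" "F \<subseteq> G" for G
  proof -
    have "dist (proj G x) x = norm ((x - y) - proj G (x - y))"
      using F(2)[OF that] by (simp add: proj_diff dist_norm norm_minus_commute)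
    also have "\<dots> \<le> norm (x - y)"
      by (rule norm_diff_proj_le[OF that(1)])
    finally show ?thesis
      using y(2) by (simp add: dist_norm norm_minus_commute)
  qed
  then show "\<forall>\<^sub>F G in finite_subsets_at_top UNIV. dist (proj G x) x < \<epsilon>"
    using F(1) by (auto simp: eventually_finite_subsets_at_top)
qed

lemma Parseval: "((\<lambda>l. cinner x (e l) * cinner (e l) y) has_sum cinner x y) UNIV"
proof -
  have "((\<lambda>G. cinner x (proj G y)) \<longlongrightarrow> cinner x y) (finite_subsets_at_top UNIV)"
    by (intro tendsto_proj cinner.tendsto tendsto_const)
  moreover have "\<forall>\<^sub>F G in finite_subsets_at_top UNIV.
      cinner x (proj G y) = (\<Sum>l\<in>G. cinner x (e l) * cinner (e l) y)"
    by (intro eventually_finite_subsets_at_top_weakI cinner_proj_right)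
  ultimately show ?thesis
    unfolding has_sum_def by (rule Lim_transform_eventually)
qed

text \<open>Riesz representation of the functional \<open>\<lambda>y. cinner x (A y)\<close>: its
  values on the basis determine the coefficients \<open>c\<close> of the representing vector, and
  the functional's boundedness makes them square summable.\<close>

lemma ex_adjoint:
  fixes A :: "'a \<Rightarrow> 'a"
  assumes A: "bounded_clinear A"
  shows "\<exists>z. \<forall>y. cinner z y = cinner x (A y)"
proof -
  interpret A: bounded_linear A
    using A by (rule bounded_clinear_imp_bounded_linear)
  define c where "c = (\<lambda>l. cnj (cinner x (A (e l))))"
  define K where "K = norm x * onorm A"
  have "K \<ge> 0"
    by (simp add: K_def onorm_pos_le A.bounded_linear_axioms)
  have bound: "(\<Sum>l\<in>F. (cmod (c l))\<^sup>2) \<le> K\<^sup>2" if "finite F" for F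
  proof -
    \<comment> \<open>The functional is tested on the partial sum of the vector to be constructed.
      The value is the sum of the squares, which is also \<open>(norm z)\<^sup>2\<close>, so the
      bound \<open>K * norm z\<close> yields \<open>norm z \<le> K\<close>.\<close>
    define z where "z = (\<Sum>l\<in>F. c l *\<^sub>C e l)"
    have "complex_of_real (\<Sum>l\<in>F. (cmod (c l))\<^sup>2) = cinner x (A z)"
      by (simp add: z_def A.sum cinner.sum_right bounded_clinear_scaleC[OF A] cinner_scaleC_right
          c_def complex_norm_square mult.commute del: of_real_power)
    then have "(\<Sum>l\<in>F. (cmod (c l))\<^sup>2) = Re (cinner x (A z))"
      by (metis Re_complex_of_real)
    also have "\<dots> \<le> norm x * norm (A z)"
      using complex_Re_le_cmod norm_cinner_le order_trans by blast
    also have "\<dots> \<le> K * norm z"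
      using onorm[OF A.bounded_linear_axioms, of z] by (simp add: K_def mult.assoc mult_left_mono)
    finally have 1: "(\<Sum>l\<in>F. (cmod (c l))\<^sup>2) \<le> K * norm z" .
    have "cinner (e l) z = c l" if "l \<in> F" for l
      using \<open>finite F\<close> that
      by (simp add: z_def cinner.sum_right cinner_scaleC_right cinner_basis if_distrib[of "(*) _"] sum.delta cong: if_cong)
    then have "proj F z = z"
      by (simp add: proj_def z_def)
    then have "(norm z)\<^sup>2 = (\<Sum>l\<in>F. (cmod (c l))\<^sup>2)"
      using norm_proj_sq[OF that, of z] \<open>\<And>l. l \<in> F \<Longrightarrow> cinner (e l) z = c l\<close> by simp
    moreover from this 1 have "norm z * norm z \<le> K * norm z"
      by (simp add: power2_eq_square)
    then have "norm z \<le> K"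
      using \<open>K \<ge> 0\<close> by (cases "z = 0") auto
    ultimately show ?thesis
      by (metis norm_ge_zero power_mono)
  qed
  have "(\<lambda>l. c l *\<^sub>C e l) summable_on UNIV"
  proof (rule summable_on_orthogonal)
    show "(\<lambda>l. (norm (c l *\<^sub>C e l))\<^sup>2) summable_on UNIV"
      using bound by (intro nonneg_bdd_above_summable_on bdd_aboveI[of _ "K\<^sup>2"]) (auto simp: norm_scaleC)
  qed (simp add: inner_eq_Re_cinner cinner_scaleC_left cinner_scaleC_right cinner_basis)
  then obtain z where z: "((\<lambda>l. c l *\<^sub>C e l) has_sum z) UNIV"
    by (auto simp: summable_on_def)
  have zl: "cinner z (e l) = cinner x (A (e l))" for l
  proof -
    have "((\<lambda>k. cinner (c k *\<^sub>C e k) (e l)) has_sum cinner z (e l)) UNIV"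
      by (rule has_sum_bounded_linear[OF cinner.bounded_linear_left z])
    moreover have "((\<lambda>k. cinner (c k *\<^sub>C e k) (e l)) has_sum cinner x (A (e l))) UNIV"
      by (rule has_sum_finite_neutralI[of "{l}"]) (auto simp: cinner_scaleC_left cinner_basis c_def)
    ultimately show ?thesis
      by (rule has_sum_unique)
  qed
  \<comment> \<open>Both sides are continuous in \<open>y\<close> and agree on the basis, hence on
    every \<open>proj G y\<close>.\<close>
  have "cinner z y = cinner x (A y)" for y
  proof -
    have "((\<lambda>G. cinner x (A (proj G y))) \<longlongrightarrow> cinner x (A y)) (finite_subsets_at_top UNIV)"
      by (intro cinner.tendsto A.tendsto tendsto_proj tendsto_const)
    moreover have "(\<lambda>G. cinner x (A (proj G y))) = (\<lambda>G. cinner z (proj G y))"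
      by (simp add: fun_eq_iff proj_def A.sum cinner.sum_right bounded_clinear_scaleC[OF A] cinner_scaleC_right zl)
    moreover have "((\<lambda>G. cinner z (proj G y)) \<longlongrightarrow> cinner z y) (finite_subsets_at_top UNIV)"
      by (intro cinner.tendsto tendsto_proj tendsto_const)
    ultimately show ?thesis
      by (simp only:) (rule tendsto_unique[OF finite_subsets_at_top_neq_bot])
  qed
  then show ?thesis by blast
qed

end

lemma cadjoint_eqI:
  assumes "\<And>x y. cinner (B x) y = cinner x (A y)"
  shows "cadjoint A = B"
  unfolding cadjoint_def
proof (rule the_equality)
  fix C assume "\<forall>x y. cinner (C x) y = cinner x (A y)"
  then show "C = B"
    using assms by (intro ext cinner_eqI) simp
qed (use assms in simp)

text \<open>\<open>cadjoint\<close> is a definite description. Existence comes from the Riesz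
  argument, uniqueness from nondegeneracy of the inner product.\<close>

lemma (in orthonormal_basis) cinner_cadjoint:
  fixes A :: "'a \<Rightarrow> 'a"
  assumes "bounded_clinear A"
  shows "cinner (cadjoint A x) y = cinner x (A y)"
proof -
  obtain B where B: "\<And>x y. cinner (B x) y = cinner x (A y)"
    using ex_adjoint[OF assms] by metis
  then show ?thesis
    by (simp add: cadjoint_eqI[OF B])
qed

section \<open>Positive operators and their square roots\<close>

definition quad_form :: "('a::chilbert_space \<Rightarrow> 'a) \<Rightarrow> 'a \<Rightarrow> real" where
  "quad_form A x = Re (cinner x (A x))"

lemma cinner_positive_op: "positive_op A \<Longrightarrow> cinner x (A x) = complex_of_real (quad_form A x)"
  unfolding quad_form_def by (rule positive_op_cinner)

lemma quad_form_nonneg: "positive_op A \<Longrightarrow> 0 \<le> quad_form A x"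
  unfolding quad_form_def by (rule positive_op_cinner)

lemma positive_op_Cauchy_Schwarz:
  assumes A: "positive_op A"
  shows "(cmod (cinner x (A y)))\<^sup>2 \<le> quad_form A x * quad_form A y"
proof -
  interpret A: bounded_linear A
    using A by (simp add: positive_op_def bounded_clinear_def)
  have scale: "A (c *\<^sub>C u) = c *\<^sub>C A u" for c u
    using A by (simp add: positive_op_def bounded_clinear_def)
  define c where "c = cinner x (A y)"
  have c': "cinner y (A x) = cnj c"
    unfolding c_def by (metis A cinner_commute positive_op_selfadjoint)
  \<comment> \<open>The form is nonnegative at \<open>x - (t * cnj c) *\<^sub>C y\<close>. The
    factor \<open>cnj c\<close> makes both mixed terms equal to \<open>t * (cmod c)\<^sup>2\<close>,
    leaving a real quadratic polynomial in \<open>t\<close>.\<close>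
  have expand: "0 \<le> quad_form A x - 2 * t * (cmod c)\<^sup>2 + t\<^sup>2 * (cmod c)\<^sup>2 * quad_form A y" for t :: real
  proof -
    let ?z = "complex_of_real t * cnj c"
    have "cinner (x - ?z *\<^sub>C y) (A (x - ?z *\<^sub>C y)) =
        cinner x (A x) - ?z * cinner x (A y) - cnj ?z * cinner y (A x) + cnj ?z * ?z * cinner y (A y)"
      by (simp add: A.diff scale cinner.diff_left cinner.diff_right cinner_scaleC_left
          cinner_scaleC_right algebra_simps)
    also have "\<dots> = complex_of_real (quad_form A x - 2 * t * (cmod c)\<^sup>2 + t\<^sup>2 * (cmod c)\<^sup>2 * quad_form A y)"
      unfolding c' c_def[symmetric] cinner_positive_op[OF A]
      using complex_norm_square[of c] by (simp add: algebra_simps power2_eq_square)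
    finally show ?thesis
      using quad_form_nonneg[OF A, of "x - ?z *\<^sub>C y"] by (simp add: quad_form_def)
  qed
  show ?thesis
  proof (cases "quad_form A y = 0")
    case True
    have "c = 0"
    proof (rule ccontr)
      assume "c \<noteq> 0"
      \<comment> \<open>With vanishing quadratic coefficient the polynomial is affine in
        \<open>t\<close>; this \<open>t\<close> would give it the value -1.\<close>
      define t where "t = (quad_form A x + 1) / (2 * (cmod c)\<^sup>2)"
      have "2 * t * (cmod c)\<^sup>2 = quad_form A x + 1"
        using \<open>c \<noteq> 0\<close> by (simp add: t_def)
      then show False
        using expand[of t] True by simp
    qed
    then show ?thesis
      using True by (simp add: c_def)
  next
    case False
    then have "0 < quad_form A y"
      using quad_form_nonneg[OF A, of y] by simp
    then show ?thesis
      \<comment> \<open>This \<open>t\<close> minimizes the polynomial when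
        \<open>c \<noteq> 0\<close>.\<close>
      using expand[of "1 / quad_form A y"] by (simp add: c_def field_simps power2_eq_square)
  qed
qed

text \<open>Cauchy-Schwarz for the form of \<open>A\<close> at the pair \<open>A x\<close>,
  \<open>x\<close>, divided by \<open>(norm (A x))\<^sup>2\<close>. Smallness of the form thereby
  passes to the vector \<open>A x\<close>.\<close>

lemma norm_positive_op_sq_le:
  assumes A: "positive_op A"
  shows "(norm (A x))\<^sup>2 \<le> onorm A * quad_form A x"
proof (cases "A x = 0")
  case True
  then show ?thesis by (simp add: quad_form_def cinner.zero_right)
next
  case False
  have bl: "bounded_linear A"
    using A by (simp add: positive_op_def bounded_clinear_def)
  have "cinner (A x) (A x) = complex_of_real ((norm (A x))\<^sup>2)"
    by (rule cinner_self)
  then have "((norm (A x))\<^sup>2)\<^sup>2 \<le> quad_form A (A x) * quad_form A x"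
    using positive_op_Cauchy_Schwarz[OF A, of "A x" x] by (simp add: norm_power)
  also have "quad_form A (A x) \<le> norm (A x) * norm (A (A x))"
    unfolding quad_form_def using complex_Re_le_cmod norm_cinner_le order_trans by blast
  also have "norm (A (A x)) \<le> onorm A * norm (A x)"
    by (rule onorm[OF bl])
  finally have "((norm (A x))\<^sup>2)\<^sup>2 \<le> norm (A x) * (onorm A * norm (A x)) * quad_form A x"
    by (simp add: mult_left_mono mult_right_mono quad_form_nonneg[OF A])
  then have "(norm (A x))\<^sup>2 * (norm (A x))\<^sup>2 \<le> (norm (A x))\<^sup>2 * (onorm A * quad_form A x)"
    by (simp add: power2_eq_square mult_ac)
  then show ?thesis
    using False by (subst (asm) mult_le_cancel_left_pos) simp_all
qed

text \<open>
  From \<open>B\<^sup>2 = C\<^sup>2\<close> one gets \<open>B D = - D C\<close> for \<open>D = B - C\<close>, so that \<open>\<langle>x, B D\<^sup>2 x\<rangle> = - \<langle>D x, C D x\<rangle> \<le> 0\<close>, while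
  \<open>\<langle>x, B D\<^sup>2 x\<rangle>\<close> is close to \<open>d \<langle>x, B x\<rangle> \<ge> 0\<close> on approximate eigenvectors \<open>x\<close> of \<open>D\<^sup>2\<close>. Uniqueness of the
  square root follows because unit vectors that nearly attain the norm of \<open>D\<close> are approximate
  eigenvectors of \<open>D\<^sup>2\<close> for \<open>d = \<parallel>D\<parallel>\<^sup>2\<close>.
\<close>

lemma positive_sqrt_approx_eigenvector:
  fixes B C :: "'a::chilbert_space \<Rightarrow> 'a" and x :: "nat \<Rightarrow> 'a" and d :: real
  defines "D \<equiv> \<lambda>x. B x - C x"
  assumes B: "positive_op B" and C: "positive_op C" and BC: "B \<circ> B = C \<circ> C"
    and "0 < d" and x: "\<And>n. norm (x n) \<le> 1"
    and lim: "(\<lambda>n. D (D (x n)) - d *\<^sub>R x n) \<longlonglongrightarrow> 0"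
  shows "(\<lambda>n. B (x n)) \<longlonglongrightarrow> 0"
proof -
  interpret B: bounded_linear B
    using B by (simp add: positive_op_def bounded_clinear_def)
  interpret C: bounded_linear C
    using C by (simp add: positive_op_def bounded_clinear_def)
  define y where "y = (\<lambda>n. D (D (x n)) - d *\<^sub>R x n)"
  have D_self: "cinner (D u) v = cinner u (D v)" for u v
    by (simp add: D_def cinner.diff_left cinner.diff_right positive_op_selfadjoint[OF B]
        positive_op_selfadjoint[OF C])
  have BD: "B (D z) = - D (C z)" for z
    using fun_cong[OF BC, of z] by (simp add: D_def B.diff)
  have bound: "quad_form B (x n) \<le> onorm B * norm (y n) / d" for n
  proof -
    have "cinner (x n) (B (D (D (x n)))) = - cinner (D (x n)) (C (D (x n)))"
      by (simp add: BD cinner.minus_right D_self)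
    then have "Re (cinner (x n) (B (D (D (x n))))) \<le> 0"
      using quad_form_nonneg[OF C, of "D (x n)"] by (simp add: quad_form_def)
    moreover have "D (D (x n)) = d *\<^sub>R x n + y n"
      by (simp add: y_def)
    ultimately have "d * quad_form B (x n) \<le> - Re (cinner (x n) (B (y n)))"
      by (simp add: quad_form_def B.add B.scaleR cinner.add_right cinner_scaleR_right)
    also have "\<dots> \<le> cmod (cinner (x n) (B (y n)))"
      using abs_Re_le_cmod[of "cinner (x n) (B (y n))"] by linarith
    also have "\<dots> \<le> norm (x n) * norm (B (y n))"
      by (rule norm_cinner_le)
    also have "\<dots> \<le> 1 * (onorm B * norm (y n))"
      by (intro mult_mono x onorm B.bounded_linear_axioms) auto
    finally show ?thesis
      using \<open>0 < d\<close> by (simp add: field_simps)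
  qed
  have "(\<lambda>n. (norm (B (x n)))\<^sup>2) \<longlonglongrightarrow> 0"
  proof (rule tendsto_sandwich[where f = "\<lambda>_. 0"])
    show "\<forall>\<^sub>F n in sequentially. (norm (B (x n)))\<^sup>2 \<le> onorm B * (onorm B * norm (y n) / d)"
      using norm_positive_op_sq_le[OF B] bound onorm_pos_le[OF B.bounded_linear_axioms]
      by (intro always_eventually allI) (meson mult_left_mono order_trans)
    have "(\<lambda>n. onorm B * (onorm B * norm (y n) / d)) \<longlonglongrightarrow> onorm B * (onorm B * 0 / d)"
      using lim \<open>0 < d\<close> unfolding y_def[symmetric] by (intro tendsto_intros tendsto_norm_zero) auto
    then show "(\<lambda>n. onorm B * (onorm B * norm (y n) / d)) \<longlonglongrightarrow> 0"
      by simp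
  qed (simp_all add: tendsto_const)
  then have "(\<lambda>n. sqrt ((norm (B (x n)))\<^sup>2)) \<longlonglongrightarrow> sqrt 0"
    by (rule tendsto_real_sqrt)
  then show ?thesis
    by (simp add: tendsto_norm_zero_iff)
qed

lemma positive_sqrt_unique:
  assumes B: "positive_op B" and C: "positive_op C" and BC: "B \<circ> B = C \<circ> C"
  shows "B = C"
proof (rule ccontr)
  assume "B \<noteq> C"
  interpret B: bounded_linear B
    using B by (simp add: positive_op_def bounded_clinear_def)
  interpret C: bounded_linear C
    using C by (simp add: positive_op_def bounded_clinear_def)
  define D where "D = (\<lambda>x. B x - C x)"
  interpret D: bounded_linear D
    unfolding D_def by (intro bounded_linear_sub B.bounded_linear_axioms C.bounded_linear_axioms)
  define d where "d = onorm D"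
  have "d > 0"
    using \<open>B \<noteq> C\<close> onorm_pos_lt[OF D.bounded_linear_axioms] by (auto simp: d_def D_def fun_eq_iff)
  \<comment> \<open>Vectors in the unit ball that nearly attain the operator norm. If
    \<open>d\<close> minus the error is negative, the zero vector already serves.\<close>
  have "\<exists>x. norm x \<le> 1 \<and> d - inverse (real (Suc n)) < norm (D x)" for n
  proof (cases "0 \<le> d - inverse (real (Suc n))")
    case True
    have "\<not> onorm D \<le> d - inverse (real (Suc n))"
      by (simp add: d_def)
    then obtain x where x: "(d - inverse (real (Suc n))) * norm x < norm (D x)"
      using onorm_bound[OF True, of D] by (meson not_le)
    then have "x \<noteq> 0"
      using D.zero by auto
    with x show ?thesis
      by (intro exI[of _ "x /\<^sub>R norm x"]) (simp add: D.scaleR field_simps)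
  next
    case False
    then show ?thesis
      by (intro exI[of _ 0]) (simp add: D.zero)
  qed
  then obtain x where x: "\<And>n. norm (x n) \<le> 1"
    and x': "\<And>n. d - inverse (real (Suc n)) < norm (D (x n))"
    by metis
  have le_d: "norm (D v) \<le> d * norm v" for v
    unfolding d_def by (rule onorm[OF D.bounded_linear_axioms])
  have le_d1: "norm (D (x n)) \<le> d" for n
    using le_d[of "x n"] x[of n] \<open>d > 0\<close> by (smt (verit) mult_left_le)
  have D_lim: "(\<lambda>n. norm (D (x n))) \<longlonglongrightarrow> d"
  proof (rule tendsto_sandwich)
    have "(\<lambda>n. d - inverse (real (Suc n))) \<longlonglongrightarrow> d - 0"
      by (intro tendsto_intros LIMSEQ_inverse_real_of_nat)
    then show "(\<lambda>n. d - inverse (real (Suc n))) \<longlonglongrightarrow> d"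
      by simp
  qed (use x'[THEN less_imp_le] le_d1 in \<open>auto simp del: of_nat_Suc\<close>)
  have D_self: "D u \<bullet> v = u \<bullet> D v" for u v
    by (simp add: D_def inner_eq_Re_cinner cinner.diff_left cinner.diff_right
        positive_op_selfadjoint[OF B] positive_op_selfadjoint[OF C])
  let ?y = "\<lambda>n. D (D (x n)) - d\<^sup>2 *\<^sub>R x n"
  \<comment> \<open>Expanding the square with \<open>D\<close> self-adjoint gives the cross term
    \<open>- 2 * d\<^sup>2 * (norm (D (x n)))\<^sup>2\<close>, while each of the two other terms is
    at most \<open>(d\<^sup>2)\<^sup>2\<close>.\<close>
  have y_le: "(norm (?y n))\<^sup>2 \<le> 2 * d\<^sup>2 * (d\<^sup>2 - (norm (D (x n)))\<^sup>2)" for n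
  proof -
    have "(norm (?y n))\<^sup>2 = (norm (D (D (x n))))\<^sup>2 - 2 * d\<^sup>2 * (norm (D (x n)))\<^sup>2 + (d\<^sup>2 * norm (x n))\<^sup>2"
      by (simp add: power2_norm_eq_inner inner_diff_left inner_diff_right inner_commute D_self
          power_mult_distrib algebra_simps)
    moreover have "norm (D (D (x n))) \<le> d\<^sup>2"
      using le_d[of "D (x n)"] le_d1[of n] \<open>d > 0\<close>
      by (smt (verit) mult_left_mono power2_eq_square)
    then have "(norm (D (D (x n))))\<^sup>2 \<le> (d\<^sup>2)\<^sup>2"
      by (intro power_mono) auto
    moreover have "(d\<^sup>2 * norm (x n))\<^sup>2 \<le> (d\<^sup>2 * 1)\<^sup>2"
      using x[of n] by (intro power_mono mult_left_mono) auto
    ultimately show ?thesis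
      by (simp add: algebra_simps power2_eq_square)
  qed
  have "(\<lambda>n. (norm (?y n))\<^sup>2) \<longlonglongrightarrow> 0"
  proof (rule tendsto_sandwich[where f = "\<lambda>_. 0"])
    have "(\<lambda>n. 2 * d\<^sup>2 * (d\<^sup>2 - (norm (D (x n)))\<^sup>2)) \<longlonglongrightarrow> 2 * d\<^sup>2 * (d\<^sup>2 - d\<^sup>2)"
      by (intro tendsto_intros D_lim)
    then show "(\<lambda>n. 2 * d\<^sup>2 * (d\<^sup>2 - (norm (D (x n)))\<^sup>2)) \<longlonglongrightarrow> 0"
      by simp
  qed (use y_le in \<open>auto simp: tendsto_const\<close>)
  then have "(\<lambda>n. sqrt ((norm (?y n))\<^sup>2)) \<longlonglongrightarrow> sqrt 0"
    by (rule tendsto_real_sqrt)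
  then have y_lim: "?y \<longlonglongrightarrow> 0"
    by (simp add: tendsto_norm_zero_iff)
  have "(\<lambda>n. B (x n)) \<longlonglongrightarrow> 0"
    using B C BC _ x y_lim[unfolded D_def]
    by (rule positive_sqrt_approx_eigenvector) (use \<open>d > 0\<close> in simp)
  \<comment> \<open>The roles of \<open>B\<close> and \<open>C\<close> are exchanged: this replaces
    \<open>D\<close> by its negative and keeps the square of \<open>D\<close>.\<close>
  moreover have "(\<lambda>n. C (x n)) \<longlonglongrightarrow> 0"
  proof (rule positive_sqrt_approx_eigenvector[OF C B BC[symmetric] _ x, of "d\<^sup>2"])
    show "(\<lambda>n. C (C (x n) - B (x n)) - B (C (x n) - B (x n)) - d\<^sup>2 *\<^sub>R x n) \<longlonglongrightarrow> 0"
      using y_lim by (simp add: D_def B.diff C.diff algebra_simps)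
  qed (use \<open>d > 0\<close> in simp)
  ultimately have "(\<lambda>n. D (x n)) \<longlonglongrightarrow> 0 - 0"
    unfolding D_def by (rule tendsto_diff)
  then have "(\<lambda>n. norm (D (x n))) \<longlonglongrightarrow> 0"
    by (intro tendsto_norm_zero) simp
  then show False
    using LIMSEQ_unique[OF D_lim] \<open>d > 0\<close> by simp
qed

text \<open>A positive \<open>A\<close> is itself a positive square root of
  \<open>cadjoint A \<circ> A\<close>, and square roots are unique. For positive operators the trace
  class condition thus becomes summability of the diagonal of \<open>A\<close>.\<close>

lemma abs_op_positive:
  assumes "positive_op A"
  shows "abs_op A = A"
proof -
  have "cadjoint A = A"
    by (rule cadjoint_eqI) (rule positive_op_selfadjoint[OF assms])
  then show ?thesis
    unfolding abs_op_def using assms positive_sqrt_unique by (intro the_equality) auto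
qed

lemma summable_quad_form:
  assumes "\<rho> \<in> pos_trace_class e"
  shows "(\<lambda>l. quad_form \<rho> (e l)) summable_on UNIV"
proof -
  have "positive_op \<rho>" "(\<lambda>l. cinner (e l) (\<rho> (e l))) summable_on UNIV"
    using assms by (auto simp: pos_trace_class_def trace_class_def abs_op_positive)
  then have "(\<lambda>l. Re (cinner (e l) (\<rho> (e l)))) summable_on UNIV"
    by (intro summable_on_Re)
  then show ?thesis
    by (simp add: quad_form_def)
qed

section \<open>Traces of conjugated positive operators\<close>

lemma norm_cinner_commute: "cmod (cinner x y) = cmod (cinner y x)"
  by (subst cinner_commute) (rule complex_mod_cnj)

text \<open>
  If \<open>quad_form A y = 0\<close> then \<open>A y = 0\<close>, and with \<open>x / 0 = 0\<close> the statement remains true.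
\<close>

lemma positive_op_Schur_complement:
  fixes A :: "'a::chilbert_space \<Rightarrow> 'a" and y :: 'a
  assumes A: "positive_op A"
  defines "B \<equiv> \<lambda>x. A x - (cinner (A y) x / quad_form A y) *\<^sub>C A y"
  shows "positive_op B" and "B y = 0"
    and "quad_form A x = quad_form B x + (cmod (cinner (A y) x))\<^sup>2 / quad_form A y"
proof -
  interpret A: bounded_linear A
    using A by (simp add: positive_op_def bounded_clinear_def)
  have CS: "(cmod (cinner (A y) x))\<^sup>2 \<le> quad_form A x * quad_form A y" for x
  proof -
    have "cmod (cinner (A y) x) = cmod (cinner x (A y))"
      by (rule norm_cinner_commute)
    then show ?thesis
      using positive_op_Cauchy_Schwarz[OF A, of x y] by simp
  qed
  have cinner_B: "cinner x (B x) = complex_of_real (quad_form A x - (cmod (cinner (A y) x))\<^sup>2 / quad_form A y)" for x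
    using cinner_mult_cinner[of x "A y"]
    by (simp add: B_def cinner.diff_right cinner_scaleC_right cinner_positive_op[OF A] mult.commute)
  then have qB: "quad_form B x = quad_form A x - (cmod (cinner (A y) x))\<^sup>2 / quad_form A y" for x
    by (simp add: quad_form_def[of B])
  then show "quad_form A x = quad_form B x + (cmod (cinner (A y) x))\<^sup>2 / quad_form A y"
    by simp
  \<comment> \<open>Nonnegativity of the remainder is exactly the Cauchy-Schwarz inequality for the
    form of \<open>A\<close>.\<close>
  have "0 \<le> quad_form B x" for x
    using CS[of x] quad_form_nonneg[OF A, of y] quad_form_nonneg[OF A, of x]
    by (cases "quad_form A y = 0") (auto simp: qB field_simps)
  moreover have "bounded_clinear B"
    unfolding bounded_clinear_def
  proof (intro conjI allI)
    show "bounded_linear B"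
      unfolding B_def divide_inverse
      by (intro bounded_linear_sub A.bounded_linear_axioms bounded_linear_compose[OF scaleC.bounded_linear_left]
          bounded_linear_compose[OF bounded_linear_mult_left] cinner.bounded_linear_right)
    show "B (c *\<^sub>C x) = c *\<^sub>C B x" for c x
      using A by (simp add: B_def positive_op_def bounded_clinear_def cinner_scaleC_right
          scaleC_scaleC scaleC.diff_right)
  qed
  ultimately show "positive_op B"
    by (simp add: positive_op_def cinner_B qB complex_nonneg_Reals_iff)
  have "cinner (A y) y = complex_of_real (quad_form A y)"
    by (simp add: positive_op_selfadjoint[OF A] cinner_positive_op[OF A])
  moreover have "A y = 0" if "quad_form A y = 0"
    using norm_positive_op_sq_le[OF A, of y] that by simp
  ultimately show "B y = 0"
    by (cases "quad_form A y = 0") (simp_all add: B_def)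
qed

context orthonormal_basis
begin

text \<open>\<open>A\<close> kills \<open>e g\<close>, and by self-adjointness its range is
  orthogonal to \<open>e g\<close>, so that component contributes neither diagonal nor mixed
  terms.\<close>

lemma quad_form_proj_insert:
  assumes A: "positive_op A" and "A (e g) = 0" "finite G" "g \<notin> G"
  shows "quad_form A (proj (insert g G) x) = quad_form A (proj G x)"
proof -
  interpret A: bounded_linear A
    using A by (simp add: positive_op_def bounded_clinear_def)
  let ?u = "cinner (e g) x *\<^sub>C e g"
  have "A ?u = 0"
    using A assms(2) by (simp add: positive_op_def bounded_clinear_def scaleC.zero_right)
  moreover from this have "cinner ?u (A v) = 0" for v
    by (metis A positive_op_selfadjoint cinner.zero_left)
  moreover have "proj (insert g G) x = ?u + proj G x"
    using assms by (simp add: proj_def)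
  ultimately show ?thesis
    by (simp add: quad_form_def A.add cinner.add_left)
qed

text \<open>
  Splitting off one rank one operator per basis vector, as in the Cholesky decomposition, avoids
  the square root of \<open>A\<close>; for a rank one operator the claim is just the hypothesis on \<open>v\<close>.
\<close>

lemma quad_form_proj_sum_le:
  fixes A :: "'a \<Rightarrow> 'a" and v :: "'k \<Rightarrow> 'a"
  assumes "finite G" and "positive_op A"
    and v: "\<And>w. (\<Sum>i\<in>F. (cmod (cinner w (v i)))\<^sup>2) \<le> K * (norm w)\<^sup>2"
  shows "(\<Sum>i\<in>F. quad_form A (proj G (v i))) \<le> K * (\<Sum>g\<in>G. quad_form A (e g))"
  using assms(1,2)
proof (induction G arbitrary: A rule: finite_induct)
  case empty
  then show ?case
    by (simp add: proj_def quad_form_def cinner.zero_left)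
next
  case (insert g G)
  let ?r = "A (e g)" and ?G = "insert g G"
  define b where "b = quad_form A (e g)"
  define B where "B = (\<lambda>x. A x - (cinner ?r x / b) *\<^sub>C ?r)"
  have B: "positive_op B" "B (e g) = 0"
    and qA: "\<And>x. quad_form A x = quad_form B x + (cmod (cinner ?r x))\<^sup>2 / b"
    unfolding B_def b_def by (rule positive_op_Schur_complement[OF insert.prems])+
  have B0: "quad_form B (e g) = 0"
    using B(2) by (simp add: quad_form_def cinner.zero_right)
  have r: "cinner ?r (proj ?G x) = cinner (proj ?G ?r) x" for x
    using insert.hyps by (simp add: cinner_proj_left cinner_proj_right)
  \<comment> \<open>The projection is moved onto \<open>?r\<close>, and the hypothesis on
    \<open>v\<close> is used for \<open>w = proj ?G ?r\<close>, whose squared norm is the sum of its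
    squared coefficients.\<close>
  have "(\<Sum>i\<in>F. (cmod (cinner ?r (proj ?G (v i))))\<^sup>2) \<le> K * (\<Sum>h\<in>?G. (cmod (cinner (e h) ?r))\<^sup>2)"
    unfolding r using v[of "proj ?G ?r"] norm_proj_sq[of ?G ?r] insert.hyps by simp
  also have "(\<Sum>h\<in>?G. (cmod (cinner (e h) ?r))\<^sup>2) = (\<Sum>h\<in>?G. (cmod (cinner ?r (e h)))\<^sup>2)"
    by (simp only: norm_cinner_commute)
  finally have rank_one: "(\<Sum>i\<in>F. (cmod (cinner ?r (proj ?G (v i))))\<^sup>2) / b
      \<le> K * ((\<Sum>h\<in>?G. (cmod (cinner ?r (e h)))\<^sup>2) / b)"
    unfolding times_divide_eq_right by (rule divide_right_mono) (simp add: b_def quad_form_nonneg[OF insert.prems])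
  \<comment> \<open>\<open>A\<close> splits into \<open>B\<close> plus the rank one part. Since
    \<open>B\<close> vanishes at \<open>e g\<close>, its share only sees \<open>G\<close>, where the
    induction hypothesis applies.\<close>
  have "(\<Sum>i\<in>F. quad_form A (proj ?G (v i)))
      = (\<Sum>i\<in>F. quad_form B (proj G (v i))) + (\<Sum>i\<in>F. (cmod (cinner ?r (proj ?G (v i))))\<^sup>2) / b"
    unfolding qA[of "proj _ _"] quad_form_proj_insert[OF B insert.hyps]
    by (simp only: sum.distrib sum_divide_distrib)
  also have "\<dots> \<le> K * (\<Sum>h\<in>G. quad_form B (e h)) + K * ((\<Sum>h\<in>?G. (cmod (cinner ?r (e h)))\<^sup>2) / b)"
    by (intro add_mono insert.IH B(1) rank_one)
  also have "\<dots> = K * (\<Sum>h\<in>?G. quad_form B (e h)) + K * ((\<Sum>h\<in>?G. (cmod (cinner ?r (e h)))\<^sup>2) / b)"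
    by (simp add: sum.insert[OF insert.hyps] B0)
  also have "\<dots> = K * (\<Sum>h\<in>?G. quad_form A (e h))"
    unfolding qA[of "e _"] by (simp only: sum.distrib sum_divide_distrib distrib_left)
  finally show ?case .
qed

text \<open>The bound for finite projections passes to the limit over \<open>G\<close>: the left
  side converges by continuity, and the partial traces on the right never exceed the full
  trace.\<close>

lemma quad_form_sum_le:
  fixes A :: "'a \<Rightarrow> 'a" and v :: "'k \<Rightarrow> 'a"
  assumes A: "positive_op A" and summable: "(\<lambda>l. quad_form A (e l)) summable_on UNIV"
    and v: "\<And>w. (\<Sum>i\<in>F. (cmod (cinner w (v i)))\<^sup>2) \<le> K * (norm w)\<^sup>2"
    and "0 \<le> K"
  shows "(\<Sum>i\<in>F. quad_form A (v i)) \<le> K * (\<Sum>\<^sub>\<infinity>l. quad_form A (e l))"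
proof -
  interpret A: bounded_linear A
    using A by (simp add: positive_op_def bounded_clinear_def)
  have "((\<lambda>G. \<Sum>i\<in>F. quad_form A (proj G (v i))) \<longlongrightarrow> (\<Sum>i\<in>F. quad_form A (v i))) (finite_subsets_at_top UNIV)"
    unfolding quad_form_def
    by (intro tendsto_sum tendsto_Re cinner.tendsto A.tendsto tendsto_proj)
  moreover have "(\<Sum>i\<in>F. quad_form A (proj G (v i))) \<le> K * (\<Sum>\<^sub>\<infinity>l. quad_form A (e l))"
    if "finite G" for G
  proof -
    have "(\<Sum>g\<in>G. quad_form A (e g)) \<le> (\<Sum>\<^sub>\<infinity>l. quad_form A (e l))"
      by (rule finite_sum_le_infsum[OF summable that]) (simp_all add: quad_form_nonneg[OF A])
    then show ?thesis
      by (rule order_trans[OF quad_form_proj_sum_le[OF that A v] mult_left_mono[OF _ \<open>0 \<le> K\<close>]])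
  qed
  then have "\<forall>\<^sub>F G in finite_subsets_at_top UNIV.
      (\<Sum>i\<in>F. quad_form A (proj G (v i))) \<le> K * (\<Sum>\<^sub>\<infinity>l. quad_form A (e l))"
    by (rule eventually_finite_subsets_at_top_weakI)
  ultimately show ?thesis
    by (rule tendsto_upperbound[OF _ _ finite_subsets_at_top_neq_bot])
qed

lemma quad_form_cadjoint_sum_le:
  fixes A U :: "'a \<Rightarrow> 'a"
  assumes A: "positive_op A" and summable: "(\<lambda>l. quad_form A (e l)) summable_on UNIV"
    and U: "bounded_clinear U" "onorm U \<le> C"
  shows "(\<lambda>l. quad_form A (cadjoint U (e l))) summable_on UNIV"
    and "(\<Sum>\<^sub>\<infinity>l. quad_form A (cadjoint U (e l))) \<le> C\<^sup>2 * (\<Sum>\<^sub>\<infinity>l. quad_form A (e l))"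
proof -
  have bl: "bounded_linear U"
    using U by (simp add: bounded_clinear_def)
  have "(\<Sum>l\<in>F. (cmod (cinner w (cadjoint U (e l))))\<^sup>2) \<le> C\<^sup>2 * (norm w)\<^sup>2" if "finite F" for F w
  proof -
    have "cmod (cinner w (cadjoint U (e l))) = cmod (cinner (e l) (U w))" for l
      by (subst norm_cinner_commute) (simp add: cinner_cadjoint[OF U(1)])
    then have "(\<Sum>l\<in>F. (cmod (cinner w (cadjoint U (e l))))\<^sup>2) \<le> (norm (U w))\<^sup>2"
      using Bessel[OF that, of "U w"] by simp
    also have "norm (U w) \<le> C * norm w"
      using onorm[OF bl, of w] mult_right_mono[OF U(2) norm_ge_zero[of w]] by linarith
    then have "(norm (U w))\<^sup>2 \<le> (C * norm w)\<^sup>2"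
      by (intro power_mono) auto
    finally show ?thesis
      by (simp add: power_mult_distrib)
  qed
  then have le: "(\<Sum>l\<in>F. quad_form A (cadjoint U (e l))) \<le> C\<^sup>2 * (\<Sum>\<^sub>\<infinity>l. quad_form A (e l))" if "finite F" for F
    using that by (intro quad_form_sum_le A summable) auto
  then show *: "(\<lambda>l. quad_form A (cadjoint U (e l))) summable_on UNIV"
    using quad_form_nonneg[OF A] by (intro nonneg_bdd_above_summable_on bdd_aboveI2) auto
  show "(\<Sum>\<^sub>\<infinity>l. quad_form A (cadjoint U (e l))) \<le> C\<^sup>2 * (\<Sum>\<^sub>\<infinity>l. quad_form A (e l))"
    using le by (intro infsum_le_finite_sums *) auto
qed

end

section \<open>Compact test operators\<close>

text \<open>Approximability by compact sets gives total boundedness. It is the tool for showing that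
  norm limits of finite rank operators are compact.\<close>

lemma compact_closure_if_approx:
  fixes S :: "'a::complete_space set"
  assumes "\<And>\<epsilon>. \<epsilon> > 0 \<Longrightarrow> \<exists>K. compact K \<and> (\<forall>x\<in>S. \<exists>y\<in>K. dist x y < \<epsilon>)"
  shows "compact (closure S)"
  unfolding compact_eq_totally_bounded
proof (intro conjI allI impI)
  show "complete (closure S)"
    by (simp add: complete_eq_closed)
  fix \<epsilon> :: real assume "0 < \<epsilon>"
  then obtain K where K: "compact K" "\<And>x. x \<in> S \<Longrightarrow> \<exists>y\<in>K. dist x y < \<epsilon>/4"
    using assms[of "\<epsilon>/4"] by auto
  moreover have "\<epsilon>/4 > 0"
    using \<open>0 < \<epsilon>\<close> by simp
  ultimately obtain k where k: "finite k" "K \<subseteq> (\<Union>x\<in>k. ball x (\<epsilon>/4))"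
    unfolding compact_eq_totally_bounded by blast
  \<comment> \<open>Two errors of \<open>\<epsilon>/4\<close> add up to \<open>\<epsilon>/2\<close>.
    The closed balls form a closed cover, which therefore also covers
    \<open>closure S\<close>.\<close>
  have "S \<subseteq> (\<Union>x\<in>k. cball x (\<epsilon>/2))"
  proof
    fix x assume "x \<in> S"
    then obtain y where y: "y \<in> K" "dist x y < \<epsilon>/4"
      using K(2) by blast
    then obtain z where "z \<in> k" "dist z y < \<epsilon>/4"
      using k(2) by auto
    then have "dist z x \<le> \<epsilon>/2"
      using y(2) dist_triangle2[of z x y] by simp
    then show "x \<in> (\<Union>x\<in>k. cball x (\<epsilon>/2))"
      using \<open>z \<in> k\<close> by auto
  qed
  moreover have "closed (\<Union>x\<in>k. cball x (\<epsilon>/2))"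
    using k(1) by (intro closed_UN) auto
  ultimately have "closure S \<subseteq> (\<Union>x\<in>k. cball x (\<epsilon>/2))"
    by (rule closure_minimal)
  also have "\<dots> \<subseteq> (\<Union>x\<in>k. ball x \<epsilon>)"
    using \<open>0 < \<epsilon>\<close> by auto
  finally show "\<exists>k. finite k \<and> closure S \<subseteq> (\<Union>x\<in>k. ball x \<epsilon>)"
    using k(1) by blast
qed

lemma image_sum_subset_compact:
  fixes A :: "'i \<Rightarrow> 'a \<Rightarrow> 'b::real_normed_vector"
  assumes "finite I" "\<And>i. i \<in> I \<Longrightarrow> \<exists>K. compact K \<and> A i ` S \<subseteq> K"
  shows "\<exists>K. compact K \<and> (\<lambda>x. \<Sum>i\<in>I. A i x) ` S \<subseteq> K"
  using assms
proof (induction I rule: finite_induct)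
  case empty
  show ?case by (intro exI[of _ "{0}"]) auto
next
  case (insert i I)
  then obtain K L where "compact K" "A i ` S \<subseteq> K" "compact L" "(\<lambda>x. \<Sum>i\<in>I. A i x) ` S \<subseteq> L"
    by (meson insertCI)
  moreover from this have "compact {x + y | x y. x \<in> K \<and> y \<in> L}"
    by (intro compact_sums)
  ultimately show ?case
    using insert.hyps by (intro exI[of _ "{x + y | x y. x \<in> K \<and> y \<in> L}"]) (auto simp: image_subset_iff)
qed

lemma rank_one_image_subset_compact:
  fixes y z :: "'a::chilbert_space"
  shows "\<exists>K. compact K \<and> (\<lambda>x. cinner y x *\<^sub>C z) ` cball 0 1 \<subseteq> K"
proof (intro exI conjI)
  show "compact ((\<lambda>c. c *\<^sub>C z) ` cball 0 (norm y))"
    by (intro compact_continuous_image linear_continuous_on scaleC.bounded_linear_left) auto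
  show "(\<lambda>x. cinner y x *\<^sub>C z) ` cball 0 1 \<subseteq> (\<lambda>c. c *\<^sub>C z) ` cball 0 (norm y)"
  proof (clarsimp, rule imageI, simp)
    fix x :: 'a assume "norm x \<le> 1"
    then show "cmod (cinner y x) \<le> norm y"
      using norm_cinner_le[of y x] mult_left_mono[of "norm x" 1 "norm y"] by simp
  qed
qed

lemma compact_op_rank_one: "compact_op (\<lambda>x. cinner y x *\<^sub>C z)"
  unfolding compact_op_def bounded_clinear_def
proof (intro conjI allI compact_closure_if_approx)
  show "bounded_linear (\<lambda>x. cinner y x *\<^sub>C z)"
    by (intro bounded_linear_compose[OF scaleC.bounded_linear_left] cinner.bounded_linear_right)
  show "cinner y (c *\<^sub>C x) *\<^sub>C z = c *\<^sub>C cinner y x *\<^sub>C z" for c x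
    by (simp add: cinner_scaleC_right scaleC_scaleC)
  show "\<exists>K. compact K \<and> (\<forall>x\<in>(\<lambda>x. cinner y x *\<^sub>C z) ` cball 0 1. \<exists>y\<in>K. dist x y < \<epsilon>)" if "\<epsilon> > 0" for \<epsilon>
    using rank_one_image_subset_compact[of y z] that by (metis dist_self subsetD)
qed

context orthonormal_basis
begin

text \<open>The trace is the Parseval expansion of \<open>cinner (A y) y\<close>. Rank one test
  operators therefore read off the quadratic form.\<close>

lemma op_trace_rank_one:
  assumes A: "positive_op A"
  shows "op_trace e ((\<lambda>x. cinner y x *\<^sub>C y) \<circ> A) = complex_of_real (quad_form A y)"
proof -
  have "cinner (e l) (cinner y (A (e l)) *\<^sub>C y) = cinner (A y) (e l) * cinner (e l) y" for l
    by (simp add: cinner_scaleC_right positive_op_selfadjoint[OF A])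
  then have "op_trace e ((\<lambda>x. cinner y x *\<^sub>C y) \<circ> A) = cinner (A y) y"
    using infsumI[OF Parseval[of "A y" y]] by (simp add: op_trace_def)
  then show ?thesis
    by (simp add: positive_op_selfadjoint[OF A] cinner_positive_op[OF A])
qed

lemma weak_star_conv_op_quad_form:
  assumes "\<And>n. positive_op (\<rho>s n)" "positive_op \<rho>" "weak_star_conv_op e \<rho>s \<rho>"
  shows "(\<lambda>n. quad_form (\<rho>s n) y) \<longlonglongrightarrow> quad_form \<rho> y"
proof -
  have "(\<lambda>n. op_trace e ((\<lambda>x. cinner y x *\<^sub>C y) \<circ> \<rho>s n)) \<longlonglongrightarrow> op_trace e ((\<lambda>x. cinner y x *\<^sub>C y) \<circ> \<rho>)"
    using assms(3) compact_op_rank_one unfolding weak_star_conv_op_def by iprover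
  then show ?thesis
    unfolding op_trace_rank_one[OF assms(1)] op_trace_rank_one[OF assms(2)]
    by (rule tendsto_of_real_iff[THEN iffD1])
qed

section \<open>Compact diagonal operators with geometric weights\<close>

lemma proj_scaleR: "proj G (r *\<^sub>R x) = r *\<^sub>R proj G x"
  using proj_scaleC[of G "complex_of_real r" x] by (simp add: scaleC_complex_of_real)

definition geom_proj :: "(nat \<Rightarrow> 'i set) \<Rightarrow> 'a \<Rightarrow> 'a" where
  "geom_proj F x = (\<Sum>k. (1/2)^k *\<^sub>R proj (F k) x)"

context
  fixes F :: "nat \<Rightarrow> 'i set"
  assumes F: "\<And>k. finite (F k)"
begin

lemma norm_geom_proj_term: "norm ((1/2)^k *\<^sub>R proj (F k) x) \<le> (1/2)^k * norm x"
  using norm_proj_le[OF F, of k x] by simp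

lemma sums_geom_proj: "(\<lambda>k. (1/2)^k *\<^sub>R proj (F k) x) sums geom_proj F x"
  unfolding geom_proj_def
proof (rule summable_sums, rule summable_comparison_test)
  show "\<exists>N. \<forall>k\<ge>N. norm ((1/2)^k *\<^sub>R proj (F k) x) \<le> (1/2)^k * norm x"
    using norm_geom_proj_term by blast
  show "summable (\<lambda>k. (1/2)^k * norm x)"
    by (intro summable_mult2 complete_algebra_summable_geometric) simp
qed

text \<open>The geometric tail bound is uniform on the unit ball, so the finite rank partial sums
  converge in operator norm; compactness rests on this.\<close>

lemma norm_geom_proj_diff_le:
  "norm (geom_proj F x - (\<Sum>k<m. (1/2)^k *\<^sub>R proj (F k) x)) \<le> 2 * (1/2)^m * norm x"
proof -
  have "(\<lambda>k. (1/2)^(k + m) *\<^sub>R proj (F (k + m)) x) sums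
      (geom_proj F x - (\<Sum>k<m. (1/2)^k *\<^sub>R proj (F k) x))"
    by (rule sums_split_initial_segment[OF sums_geom_proj])
  moreover have "(\<lambda>k. (1/2)^k * ((1/2)^m * norm x)) sums (1 / (1 - 1/2) * ((1/2)^m * norm x))"
    by (intro sums_mult2 geometric_sums) simp
  moreover have "norm ((1/2)^(k + m) *\<^sub>R proj (F (k + m)) x) \<le> (1/2)^k * ((1/2)^m * norm x)" for k
    using norm_geom_proj_term[of "k + m" x] by (simp add: power_add mult_ac)
  ultimately show ?thesis
    using norm_suminf_le[of "\<lambda>k. (1/2)^(k + m) *\<^sub>R proj (F (k + m)) x" "\<lambda>k. (1/2)^k * ((1/2)^m * norm x)"]
    by (simp add: sums_iff)
qed

lemma compact_op_geom_proj: "compact_op (geom_proj F)"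
  unfolding compact_op_def bounded_clinear_def
proof (intro conjI allI compact_closure_if_approx)
  show "bounded_linear (geom_proj F)"
  proof (rule bounded_linear_intro)
    show "geom_proj F (x + y) = geom_proj F x + geom_proj F y" for x y
      using sums_add[OF sums_geom_proj sums_geom_proj, of x y]
      by (intro sums_unique2[OF sums_geom_proj]) (simp add: proj_add scaleR_add_right)
    show "geom_proj F (r *\<^sub>R x) = r *\<^sub>R geom_proj F x" for r x
      using bounded_linear.sums[OF bounded_linear_scaleR_right sums_geom_proj, of r x]
      by (intro sums_unique2[OF sums_geom_proj]) (simp add: proj_scaleR mult.commute)
    show "norm (geom_proj F x) \<le> norm x * 2" for x
      using norm_geom_proj_diff_le[of x 0] by simp
  qed
  show "geom_proj F (c *\<^sub>C x) = c *\<^sub>C geom_proj F x" for c x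
    using bounded_linear.sums[OF scaleC.bounded_linear_right sums_geom_proj, of c x]
    by (intro sums_unique2[OF sums_geom_proj]) (simp add: proj_scaleC scaleC.scaleR_right)
  fix \<epsilon> :: real assume "0 < \<epsilon>"
  \<comment> \<open>The factor 2 of the tail bound explains \<open>\<epsilon>/2\<close>.\<close>
  then obtain m where m: "(1/2)^m < \<epsilon>/2"
    using real_arch_pow_inv[of "\<epsilon>/2" "1/2"] by auto
  have proj: "\<exists>K. compact K \<and> (\<lambda>x. (1/2)^k *\<^sub>R proj (F k) x) ` cball 0 1 \<subseteq> K" for k
  proof -
    obtain K where K: "compact K" "proj (F k) ` cball 0 1 \<subseteq> K"
      using image_sum_subset_compact[OF F rank_one_image_subset_compact] unfolding proj_def by blast
    then show ?thesis
      using compact_scaling[OF K(1), of "(1/2)^k"] by (intro exI[of _ "(\<lambda>x. (1/2)^k *\<^sub>R x) ` K"]) auto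
  qed
  obtain K where K: "compact K" "(\<lambda>x. \<Sum>k<m. (1/2)^k *\<^sub>R proj (F k) x) ` cball 0 1 \<subseteq> K"
    using image_sum_subset_compact[of "{..<m}" "\<lambda>k x. (1/2)^k *\<^sub>R proj (F k) x" "cball 0 1"] proj by auto
  have "\<exists>y\<in>K. dist (geom_proj F x) y < \<epsilon>" if "x \<in> cball 0 1" for x
  proof
    show "(\<Sum>k<m. (1/2)^k *\<^sub>R proj (F k) x) \<in> K"
      using K(2) that by auto
    have "dist (geom_proj F x) (\<Sum>k<m. (1/2)^k *\<^sub>R proj (F k) x) \<le> 2 * (1/2)^m * norm x"
      using norm_geom_proj_diff_le[of x m] by (simp add: dist_norm)
    also have "\<dots> \<le> 2 * (1/2)^m * 1"
      using that by (intro mult_left_mono) auto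
    finally show "dist (geom_proj F x) (\<Sum>k<m. (1/2)^k *\<^sub>R proj (F k) x) < \<epsilon>"
      using m by simp
  qed
  then show "\<exists>K. compact K \<and> (\<forall>x\<in>geom_proj F ` cball 0 1. \<exists>y\<in>K. dist x y < \<epsilon>)"
    using K(1) by blast
qed

text \<open>\<open>geom_proj F\<close> is diagonal with eigenvalues \<open>c l\<close>, which are at
  least \<open>(1/2)^k\<close> on \<open>F k\<close>. All terms of the weighted trace are
  nonnegative, so those outside \<open>F k\<close> may be dropped.\<close>

lemma op_trace_geom_proj_ge:
  assumes A: "positive_op A" and summable: "(\<lambda>l. quad_form A (e l)) summable_on UNIV"
  shows "(1/2)^k * (\<Sum>l\<in>F k. quad_form A (e l)) \<le> Re (op_trace e (geom_proj F \<circ> A))"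
proof -
  define c where "c = (\<lambda>l. \<Sum>k. (1/2)^k * (of_bool (l \<in> F k) :: real))"
  have summable_c: "summable (\<lambda>k. (1/2)^k * (of_bool (l \<in> F k) :: real))" for l
    by (rule summable_comparison_test[of _ "\<lambda>k. (1/2)^k"]) (auto intro!: exI[of _ 0] complete_algebra_summable_geometric)
  \<comment> \<open>The upper bound on the eigenvalues ensures that the weighted trace
    converges.\<close>
  have c_le: "c l \<le> 2" for l
  proof -
    have "c l \<le> (\<Sum>k. (1/2)^k)"
      unfolding c_def by (intro suminf_le summable_c complete_algebra_summable_geometric) auto
    then show ?thesis
      by (simp add: suminf_geometric)
  qed
  have c_nonneg: "0 \<le> c l" for l
    unfolding c_def by (intro suminf_nonneg summable_c) simp
  have c_ge: "(1/2)^k \<le> c l" if "l \<in> F k" for k l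
    using sum_le_suminf[OF summable_c[of l], of "{k}"] that by (simp add: c_def)
  have cinner_geom: "cinner (e l) (geom_proj F x) = c l *\<^sub>R cinner (e l) x" for l x
  proof -
    have "(\<lambda>k. cinner (e l) ((1/2)^k *\<^sub>R proj (F k) x)) sums cinner (e l) (geom_proj F x)"
      by (rule bounded_linear.sums[OF cinner.bounded_linear_right sums_geom_proj])
    moreover have "(\<lambda>k. ((1/2)^k * of_bool (l \<in> F k)) *\<^sub>R cinner (e l) x) sums (c l *\<^sub>R cinner (e l) x)"
      unfolding c_def by (intro bounded_linear.sums[OF bounded_linear_scaleR_left] summable_sums summable_c)
    moreover have "cinner (e l) ((1/2)^k *\<^sub>R proj (F k) x) = ((1/2)^k * of_bool (l \<in> F k)) *\<^sub>R cinner (e l) x" for k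
      by (simp add: cinner_scaleR_right cinner_basis_proj[OF F])
    ultimately show ?thesis
      by (simp add: sums_iff)
  qed
  have sum_c: "(\<lambda>l. c l * quad_form A (e l)) summable_on UNIV"
    by (rule summable_on_comparison_test[OF summable_on_cmult_right[OF summable, of 2]])
      (auto intro: mult_right_mono c_le mult_nonneg_nonneg c_nonneg quad_form_nonneg[OF A])
  have "op_trace e (geom_proj F \<circ> A) = (\<Sum>\<^sub>\<infinity>l. complex_of_real (c l * quad_form A (e l)))"
    by (simp add: op_trace_def cinner_geom cinner_positive_op[OF A] scaleR_conv_of_real)
  also have "\<dots> = complex_of_real (\<Sum>\<^sub>\<infinity>l. c l * quad_form A (e l))"
    by (intro infsumI has_sum_of_real has_sum_infsum sum_c)
  finally have tr: "Re (op_trace e (geom_proj F \<circ> A)) = (\<Sum>\<^sub>\<infinity>l. c l * quad_form A (e l))"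
    by simp
  have "(1/2)^k * (\<Sum>l\<in>F k. quad_form A (e l)) \<le> (\<Sum>l\<in>F k. c l * quad_form A (e l))"
    unfolding sum_distrib_left by (intro sum_mono mult_right_mono c_ge quad_form_nonneg[OF A])
  also have "\<dots> \<le> (\<Sum>\<^sub>\<infinity>l. c l * quad_form A (e l))"
    by (intro finite_sum_le_infsum sum_c F mult_nonneg_nonneg c_nonneg quad_form_nonneg[OF A]) auto
  finally show ?thesis
    by (simp add: tr)
qed

end

lemma weak_star_conv_op_trace_bounded:
  assumes \<rho>s: "\<And>n. \<rho>s n \<in> pos_trace_class e" and conv: "weak_star_conv_op e \<rho>s \<rho>"
  obtains S where "\<And>n. (\<Sum>\<^sub>\<infinity>l. quad_form (\<rho>s n) (e l)) \<le> S"
proof (rule ccontr)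
  assume "\<not> thesis"
  then have unbounded: "\<exists>n. S < (\<Sum>\<^sub>\<infinity>l. quad_form (\<rho>s n) (e l))" for S
    using that by (meson not_le)
  have pos: "positive_op (\<rho>s n)" for n
    using \<rho>s by (simp add: pos_trace_class_def)
  have summable: "(\<lambda>l. quad_form (\<rho>s n) (e l)) summable_on UNIV" for n
    by (rule summable_quad_form[OF \<rho>s])
  \<comment> \<open>\<open>4^k\<close> is chosen to beat the weight \<open>(1/2)^k\<close>: the
    pairing with \<open>\<rho>s (n k)\<close> then exceeds \<open>2^k\<close>, whereas a convergent
    sequence of pairings is bounded.\<close>
  have "\<exists>n F. finite F \<and> 4^k < (\<Sum>l\<in>F. quad_form (\<rho>s n) (e l))" for k :: nat
  proof -
    obtain n where "4^k < (\<Sum>\<^sub>\<infinity>l. quad_form (\<rho>s n) (e l))"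
      using unbounded by blast
    then show ?thesis
      using infsum_le_finite_sums[OF summable, of n "4^k"] by (meson not_le)
  qed
  then obtain n F where F: "\<And>k. finite (F k)"
    and large: "\<And>k. 4^k < (\<Sum>l\<in>F k. quad_form (\<rho>s (n k)) (e l))"
    by metis
  have "(\<lambda>n. op_trace e (geom_proj F \<circ> \<rho>s n)) \<longlonglongrightarrow> op_trace e (geom_proj F \<circ> \<rho>)"
    using conv compact_op_geom_proj[OF F] unfolding weak_star_conv_op_def by iprover
  then have "Bseq (\<lambda>n. op_trace e (geom_proj F \<circ> \<rho>s n))"
    by (intro convergent_imp_Bseq convergentI)
  then obtain M where M: "\<And>n. cmod (op_trace e (geom_proj F \<circ> \<rho>s n)) \<le> M"
    by (auto simp: Bseq_def)
  obtain k where "M < 2^k"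
    using real_arch_pow[of 2 M] by auto
  also have "(2::real)^k = (1/2)^k * 4^k"
    by (simp flip: power_mult_distrib)
  also have "\<dots> \<le> (1/2)^k * (\<Sum>l\<in>F k. quad_form (\<rho>s (n k)) (e l))"
    using large[of k] by (intro mult_left_mono) auto
  also have "\<dots> \<le> Re (op_trace e (geom_proj F \<circ> \<rho>s (n k)))"
    by (rule op_trace_geom_proj_ge[OF F pos summable])
  also have "\<dots> \<le> M"
    by (rule order_trans[OF complex_Re_le_cmod M])
  finally show False
    by simp
qed

end

section \<open>Sequence spaces and Bochner spaces\<close>

text \<open>The everywhere defined \<open>lim\<close> is measurable, and in a complete measure space
  a function that agrees with it almost everywhere is measurable too.\<close>

lemma (in complete_measure) borel_measurable_AE_LIMSEQ:
  fixes f :: "nat \<Rightarrow> 'a \<Rightarrow> 'b::{banach, second_countable_topology}"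
  assumes f: "\<And>n. f n \<in> borel_measurable M" and lim: "AE x in M. (\<lambda>n. f n x) \<longlonglongrightarrow> g x"
  shows "g \<in> borel_measurable M"
proof (rule measurableI)
  fix A :: "'b set" assume A: "A \<in> sets borel"
  have h: "(\<lambda>x. lim (\<lambda>n. f n x)) \<in> borel_measurable M"
    by (intro borel_measurable_lim_metric f)
  have "AE x in M. x \<in> (\<lambda>x. lim (\<lambda>n. f n x)) -` A \<inter> space M \<longleftrightarrow> x \<in> g -` A \<inter> space M"
    using lim by eventually_elim (simp add: limI)
  then show "g -` A \<inter> space M \<in> sets M"
    by (rule in_sets_AE) (use measurable_sets[OF h A] in auto)
qed simp

lemma complete_measure_lebesgue_on:
  assumes "I \<in> sets lebesgue"
  shows "complete_measure (lebesgue_on I)"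
proof
  fix A B assume "A \<subseteq> B" "B \<in> null_sets (lebesgue_on I)"
  then have "A \<subseteq> I" "A \<in> null_sets lebesgue"
    using assms completion.complete2[of A B lborel] by (auto simp: null_sets_restrict_space)
  then have "A \<in> null_sets (lebesgue_on I)"
    using assms by (simp add: null_sets_restrict_space)
  then show "A \<in> sets (lebesgue_on I)"
    by auto
qed

text \<open>Sums over the integers are limits of nets. Symmetric intervals extract a sequence, as
  needed for measurability of the limit.\<close>

lemma filterlim_int_intervals: "filterlim (\<lambda>n. {- int n..int n}) (finite_subsets_at_top UNIV) sequentially"
  unfolding filterlim_finite_subsets_at_top
proof (intro allI impI)
  fix X :: "int set" assume "finite X \<and> X \<subseteq> UNIV"
  moreover have "\<forall>\<^sub>F n in sequentially. x \<in> {- int n..int n}" for x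
    using eventually_ge_at_top[of "nat \<bar>x\<bar>"] by eventually_elim auto
  ultimately have "\<forall>\<^sub>F n in sequentially. \<forall>x\<in>X. x \<in> {- int n..int n}"
    by (intro eventually_ball_finite) auto
  then show "\<forall>\<^sub>F n in sequentially. finite {- int n..int n} \<and> X \<subseteq> {- int n..int n} \<and> {- int n..int n} \<subseteq> UNIV"
    by eventually_elim auto
qed

section \<open>Coordinate bounds, differences and inclusions for the sequence spaces\<close>

lemma abs_le_lp_norm:
  assumes "a \<in> lp_space q" "1 \<le> q"
  shows "\<bar>a l\<bar> \<le> lp_norm q a"
proof -
  have "(\<Sum>l\<in>{l}. \<bar>a l\<bar> powr q) \<le> (\<Sum>\<^sub>\<infinity>l. \<bar>a l\<bar> powr q)"
    using assms by (intro finite_sum_le_infsum) (auto simp: lp_space_def)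
  then have "(\<bar>a l\<bar> powr q) powr (1/q) \<le> lp_norm q a"
    unfolding lp_norm_def using assms by (intro powr_mono2) auto
  then show ?thesis
    using assms by (simp add: powr_powr)
qed

lemma lp_space_diff:
  assumes a: "a \<in> lp_space q" and b: "b \<in> lp_space q" and "1 \<le> q"
  shows "(\<lambda>l. a l - b l) \<in> lp_space q"
  unfolding lp_space_def mem_Collect_eq
proof (rule summable_on_comparison_test)
  show "(\<lambda>l. 2 powr q * (\<bar>a l\<bar> powr q + \<bar>b l\<bar> powr q)) summable_on UNIV"
    using a b by (intro summable_on_cmult_right summable_on_add) (auto simp: lp_space_def)
  show "\<bar>a l - b l\<bar> powr q \<le> 2 powr q * (\<bar>a l\<bar> powr q + \<bar>b l\<bar> powr q)" for l
  proof -
    have "\<bar>a l - b l\<bar> powr q \<le> (2 * max \<bar>a l\<bar> \<bar>b l\<bar>) powr q"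
      using \<open>1 \<le> q\<close> by (intro powr_mono2) auto
    also have "\<dots> = 2 powr q * (max \<bar>a l\<bar> \<bar>b l\<bar>) powr q"
      by (simp add: powr_mult)
    also have "(max \<bar>a l\<bar> \<bar>b l\<bar>) powr q \<le> \<bar>a l\<bar> powr q + \<bar>b l\<bar> powr q"
      by (simp add: max_def)
    finally show ?thesis
      by simp
  qed
qed simp

text \<open>If a finite \<open>F\<close> captures the sum up to \<open>\<epsilon>\<close>, no single
  term outside \<open>F\<close> can reach \<open>\<epsilon>\<close>.\<close>

lemma summable_on_tendsto_cofinite:
  fixes f :: "'i \<Rightarrow> real"
  assumes "f summable_on UNIV" "\<And>i. 0 \<le> f i"
  shows "(f \<longlongrightarrow> 0) cofinite"
proof (rule tendstoI)
  fix \<epsilon> :: real assume "\<epsilon> > 0"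
  have "\<forall>\<^sub>F F in finite_subsets_at_top UNIV. infsum f UNIV - \<epsilon> < sum f F"
    using order_tendstoD(1)[OF infsum_tendsto[OF assms(1)], of "infsum f UNIV - \<epsilon>"] \<open>\<epsilon> > 0\<close> by simp
  then obtain F where F: "finite F" "infsum f UNIV - \<epsilon> < sum f F"
    by (auto simp: eventually_finite_subsets_at_top)
  have "dist (f i) 0 < \<epsilon>" if "i \<notin> F" for i
  proof -
    have "sum f (insert i F) \<le> infsum f UNIV"
      using assms F by (intro finite_sum_le_infsum) auto
    then show ?thesis
      using that F assms(2)[of i] by simp
  qed
  then have "{i. \<not> dist (f i) 0 < \<epsilon>} \<subseteq> F"
    by blast
  then show "\<forall>\<^sub>F i in cofinite. dist (f i) 0 < \<epsilon>"
    unfolding eventually_cofinite using F(1) by (rule finite_subset)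
qed

text \<open>Allows the preduals for \<open>p > 1\<close> to be handled like the one for
  \<open>p = 1\<close>.\<close>

lemma lp_space_subset_c0:
  assumes "1 \<le> q"
  shows "lp_space q \<subseteq> c0_space"
proof
  fix a assume "a \<in> lp_space q"
  then have "((\<lambda>l. \<bar>a l\<bar> powr q) \<longlongrightarrow> 0) cofinite"
    by (intro summable_on_tendsto_cofinite) (auto simp: lp_space_def)
  then have "((\<lambda>l. (\<bar>a l\<bar> powr q) powr (1/q)) \<longlongrightarrow> 0 powr (1/q)) cofinite"
    using assms by (intro tendsto_powr2 tendsto_const) auto
  then have "((\<lambda>l. \<bar>a l\<bar>) \<longlongrightarrow> 0) cofinite"
    using assms by (simp add: powr_powr)
  then show "a \<in> c0_space"
    by (simp add: c0_space_def tendsto_rabs_zero_iff)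
qed

text \<open>Only finitely many entries have modulus at least 1, so the supremum is taken over a
  bounded set.\<close>

lemma abs_le_sup_norm:
  assumes "a \<in> c0_space"
  shows "\<bar>a l\<bar> \<le> sup_norm a"
proof -
  have "finite {l. \<not> dist (a l) 0 < 1}"
    using assms tendstoD[of a 0 cofinite 1] by (simp add: c0_space_def eventually_cofinite)
  then have fin: "finite ((\<lambda>l. \<bar>a l\<bar>) ` {l. \<not> \<bar>a l\<bar> < 1})"
    by simp
  have "bdd_above (range (\<lambda>l. \<bar>a l\<bar>))"
  proof (rule bdd_above_mono)
    show "bdd_above ((\<lambda>l. \<bar>a l\<bar>) ` {l. \<not> \<bar>a l\<bar> < 1} \<union> {..1})"
      using fin by simp
  qed auto
  then show ?thesis
    unfolding sup_norm_def by (intro cSUP_upper) auto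
qed

lemma c0_space_diff:
  assumes "a \<in> c0_space" "b \<in> c0_space"
  shows "(\<lambda>l. a l - b l) \<in> c0_space"
  using assms tendsto_diff[of a 0 cofinite b 0] by (simp add: c0_space_def)

text \<open>The norm dominates every coordinate, so the coordinates of the approximating simple
  functions converge almost everywhere.\<close>

lemma L2_space_coordinate_measurable:
  assumes f: "f \<in> L2_space I X N" and "I \<in> sets lebesgue"
    and coord: "\<And>a l. a \<in> X \<Longrightarrow> \<bar>a l\<bar> \<le> N a"
    and diff: "\<And>a b. a \<in> X \<Longrightarrow> b \<in> X \<Longrightarrow> (\<lambda>l. a l - b l) \<in> X"
  shows "(\<lambda>\<theta>. f \<theta> l) \<in> borel_measurable (lebesgue_on I)"
proof -
  interpret complete_measure "lebesgue_on I"
    by (rule complete_measure_lebesgue_on) fact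
  obtain s where s: "\<And>n. simple_function (lebesgue_on I) (s n)" "\<And>n. s n ` space (lebesgue_on I) \<subseteq> X"
    and lim: "AE \<theta> in lebesgue_on I. (\<lambda>n. N (\<lambda>l. s n \<theta> l - f \<theta> l)) \<longlonglongrightarrow> 0"
    using f by (auto simp: L2_space_def strongly_measurable_def)
  have fX: "AE \<theta> in lebesgue_on I. f \<theta> \<in> X"
    using f by (simp add: L2_space_def)
  show ?thesis
  proof (rule borel_measurable_AE_LIMSEQ)
    show "(\<lambda>\<theta>. s n \<theta> l) \<in> borel_measurable (lebesgue_on I)" for n
      by (intro borel_measurable_simple_function simple_function_compose1[OF s(1)])
    show "AE \<theta> in lebesgue_on I. (\<lambda>n. s n \<theta> l) \<longlonglongrightarrow> f \<theta> l"
      using fX lim AE_space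
    proof eventually_elim
      case (elim \<theta>)
      have "norm (s n \<theta> l - f \<theta> l) \<le> N (\<lambda>l. s n \<theta> l - f \<theta> l)" for n
        unfolding real_norm_def
        by (rule coord[OF diff[of "s n \<theta>" "f \<theta>"]]) (use s(2)[of n] elim in auto)
      then have "(\<lambda>n. s n \<theta> l - f \<theta> l) \<longlonglongrightarrow> 0"
        by (intro Lim_null_comparison[OF always_eventually elim(2)] allI)
      then show ?case
        by (rule LIM_zero_cancel)
    qed
  qed
qed

section \<open>Convergence of pairings, pointwise and integrated\<close>

lemma l1_pairing_bound:
  fixes g b :: "'i \<Rightarrow> real"
  assumes g: "\<And>i. i \<in> A \<Longrightarrow> \<bar>g i\<bar> \<le> G" and b: "\<And>i. i \<in> A \<Longrightarrow> 0 \<le> b i" "b summable_on A"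
  shows "(\<lambda>i. g i * b i) summable_on A" and "\<bar>\<Sum>\<^sub>\<infinity>i\<in>A. g i * b i\<bar> \<le> G * (\<Sum>\<^sub>\<infinity>i\<in>A. b i)"
proof -
  have le: "\<bar>g i * b i\<bar> \<le> G * b i" if "i \<in> A" for i
    using g[OF that] b(1)[OF that] by (simp add: abs_mult mult_right_mono)
  have Gb: "(\<lambda>i. G * b i) summable_on A"
    by (intro summable_on_cmult_right b)
  have abs: "(\<lambda>i. norm (g i * b i)) summable_on A"
    using le by (intro Infinite_Sum.abs_summable_on_comparison_test'[OF Gb]) simp
  then show "(\<lambda>i. g i * b i) summable_on A"
    by (rule abs_summable_summable)
  have "\<bar>\<Sum>\<^sub>\<infinity>i\<in>A. g i * b i\<bar> \<le> (\<Sum>\<^sub>\<infinity>i\<in>A. norm (g i * b i))"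
    using norm_infsum_bound[OF abs] by simp
  also have "\<dots> \<le> (\<Sum>\<^sub>\<infinity>i\<in>A. G * b i)"
    using le by (intro infsum_mono abs Gb) simp
  also have "\<dots> = G * (\<Sum>\<^sub>\<infinity>i\<in>A. b i)"
    by (intro infsum_cmult_right b)
  finally show "\<bar>\<Sum>\<^sub>\<infinity>i\<in>A. g i * b i\<bar> \<le> G * (\<Sum>\<^sub>\<infinity>i\<in>A. b i)" .
qed

text \<open>Off a finite set \<open>g\<close> is uniformly small, and the masses are bounded by
  \<open>K\<close>, so the tails are small uniformly in \<open>n\<close>; on the finite set
  coordinatewise convergence suffices.\<close>

lemma c0_pairing_tendsto:
  assumes g: "g \<in> c0_space"
    and b: "\<And>n l. 0 \<le> b n l" "\<And>n. b n summable_on UNIV" "\<And>n. (\<Sum>\<^sub>\<infinity>l. b n l) \<le> K"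
    and c: "\<And>l. 0 \<le> c l" "c summable_on UNIV" "(\<Sum>\<^sub>\<infinity>l. c l) \<le> K"
    and lim: "\<And>l. (\<lambda>n. b n l) \<longlonglongrightarrow> c l"
  shows "(\<lambda>n. \<Sum>\<^sub>\<infinity>l. g l * b n l) \<longlonglongrightarrow> (\<Sum>\<^sub>\<infinity>l. g l * c l)"
proof (rule tendstoI)
  fix \<epsilon> :: real assume "\<epsilon> > 0"
  have "0 \<le> K"
    using c infsum_nonneg[of UNIV c] by (meson order_trans)
  \<comment> \<open>\<open>K + 1\<close> keeps the denominator positive when \<open>K = 0\<close>.
    Two tails and the finite part each cost at most \<open>\<epsilon>/4\<close>.\<close>
  define \<delta> where "\<delta> = \<epsilon> / (4 * (K + 1))"
  have "\<delta> > 0"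
    using \<open>\<epsilon> > 0\<close> \<open>0 \<le> K\<close> by (simp add: \<delta>_def)
  have "\<delta> * K \<le> \<epsilon> / 4"
    using \<open>\<epsilon> > 0\<close> \<open>0 \<le> K\<close> by (simp add: \<delta>_def field_simps)
  define F where "F = {l. \<not> dist (g l) 0 < \<delta>}"
  have "finite F"
    using g tendstoD[of g 0 cofinite \<delta>] \<open>\<delta> > 0\<close> by (simp add: c0_space_def eventually_cofinite F_def)
  have split: "\<bar>(\<Sum>\<^sub>\<infinity>l. g l * d l) - (\<Sum>l\<in>F. g l * d l)\<bar> \<le> \<epsilon> / 4"
    if d: "\<And>l. 0 \<le> d l" "d summable_on UNIV" "(\<Sum>\<^sub>\<infinity>l. d l) \<le> K" for d
  proof -
    have gd: "(\<lambda>l. g l * d l) summable_on UNIV"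
      by (rule l1_pairing_bound(1)[OF abs_le_sup_norm[OF g]]) (use d in auto)
    have "(\<Sum>\<^sub>\<infinity>l. g l * d l) - (\<Sum>l\<in>F. g l * d l) = (\<Sum>\<^sub>\<infinity>l\<in>- F. g l * d l)"
      using infsum_Diff[OF gd, of F] \<open>finite F\<close> by (simp add: Compl_eq_Diff_UNIV)
    also have "\<bar>\<dots>\<bar> \<le> \<delta> * (\<Sum>\<^sub>\<infinity>l\<in>- F. d l)"
      by (rule l1_pairing_bound(2)) (use d in \<open>auto simp: F_def intro: summable_on_subset_banach\<close>)
    also have "\<dots> \<le> \<delta> * K"
      using \<open>\<delta> > 0\<close> d infsum_mono2[of d "- F" UNIV]
      by (intro mult_left_mono) (auto intro: summable_on_subset_banach order_trans)
    finally show ?thesis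
      using \<open>\<delta> * K \<le> \<epsilon> / 4\<close> by linarith
  qed
  have "(\<lambda>n. \<Sum>l\<in>F. g l * b n l) \<longlonglongrightarrow> (\<Sum>l\<in>F. g l * c l)"
    by (intro tendsto_intros lim)
  then have "\<forall>\<^sub>F n in sequentially. dist (\<Sum>l\<in>F. g l * b n l) (\<Sum>l\<in>F. g l * c l) < \<epsilon> / 4"
    by (rule tendstoD) (use \<open>\<epsilon> > 0\<close> in simp)
  then show "\<forall>\<^sub>F n in sequentially. dist (\<Sum>\<^sub>\<infinity>l. g l * b n l) (\<Sum>\<^sub>\<infinity>l. g l * c l) < \<epsilon>"
  proof eventually_elim
    case (elim n)
    then show ?case
      using split[of "b n", OF b] split[of c, OF c] \<open>\<epsilon> > 0\<close> unfolding dist_real_def by linarith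
  qed
qed

text \<open>Dominated convergence in \<open>\<theta>\<close>. The space \<open>X\<close> with norm
  \<open>N\<close> stands for either kind of predual value space.\<close>

lemma L2_pairing_tendsto:
  assumes f: "f \<in> L2_space I X N" and I: "I \<in> sets lebesgue" "bounded I"
    and X: "X \<subseteq> c0_space" and coord: "\<And>a l. a \<in> X \<Longrightarrow> \<bar>a l\<bar> \<le> N a"
    and diff: "\<And>a b. a \<in> X \<Longrightarrow> b \<in> X \<Longrightarrow> (\<lambda>l. a l - b l) \<in> X"
    and meas: "\<And>n l. (\<lambda>\<theta>. b n \<theta> l) \<in> borel_measurable (lebesgue_on I)"
      "\<And>l. (\<lambda>\<theta>. c \<theta> l) \<in> borel_measurable (lebesgue_on I)"
    and b: "\<And>n \<theta> l. \<theta> \<in> I \<Longrightarrow> 0 \<le> b n \<theta> l" "\<And>n \<theta>. \<theta> \<in> I \<Longrightarrow> b n \<theta> summable_on UNIV"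
      "\<And>n \<theta>. \<theta> \<in> I \<Longrightarrow> (\<Sum>\<^sub>\<infinity>l. b n \<theta> l) \<le> K"
    and c: "\<And>\<theta> l. \<theta> \<in> I \<Longrightarrow> 0 \<le> c \<theta> l" "\<And>\<theta>. \<theta> \<in> I \<Longrightarrow> c \<theta> summable_on UNIV"
      "\<And>\<theta>. \<theta> \<in> I \<Longrightarrow> (\<Sum>\<^sub>\<infinity>l. c \<theta> l) \<le> K"
    and lim: "\<And>\<theta> l. \<theta> \<in> I \<Longrightarrow> (\<lambda>n. b n \<theta> l) \<longlonglongrightarrow> c \<theta> l"
  shows "(\<lambda>n. L2_pairing I f (b n)) \<longlonglongrightarrow> L2_pairing I f c"
proof -
  interpret complete_measure "lebesgue_on I"
    by (rule complete_measure_lebesgue_on) fact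
  interpret finite_measure "lebesgue_on I"
    using I by (intro finite_measure_lebesgue_on bounded_set_imp_lmeasurable)
  have fX: "AE \<theta> in lebesgue_on I. f \<theta> \<in> X \<and> \<theta> \<in> I"
    using f AE_space[of "lebesgue_on I"] by (auto simp: L2_space_def)
  have f_meas: "(\<lambda>\<theta>. f \<theta> l) \<in> borel_measurable (lebesgue_on I)" for l
    by (rule L2_space_coordinate_measurable[OF f I(1) coord diff])
  have pairing_meas: "(\<lambda>\<theta>. \<Sum>\<^sub>\<infinity>l. f \<theta> l * d \<theta> l) \<in> borel_measurable (lebesgue_on I)"
    if d: "\<And>l. (\<lambda>\<theta>. d \<theta> l) \<in> borel_measurable (lebesgue_on I)"
      "\<And>\<theta> l. \<theta> \<in> I \<Longrightarrow> 0 \<le> d \<theta> l" "\<And>\<theta>. \<theta> \<in> I \<Longrightarrow> d \<theta> summable_on UNIV" for d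
  proof (rule borel_measurable_AE_LIMSEQ)
    show "(\<lambda>\<theta>. \<Sum>l\<in>{- int n..int n}. f \<theta> l * d \<theta> l) \<in> borel_measurable (lebesgue_on I)" for n
      by (intro borel_measurable_sum borel_measurable_times f_meas d)
    show "AE \<theta> in lebesgue_on I.
        (\<lambda>n. \<Sum>l\<in>{- int n..int n}. f \<theta> l * d \<theta> l) \<longlonglongrightarrow> (\<Sum>\<^sub>\<infinity>l. f \<theta> l * d \<theta> l)"
      using fX
    proof eventually_elim
      case (elim \<theta>)
      have "(\<lambda>l. f \<theta> l * d \<theta> l) summable_on UNIV"
        by (rule l1_pairing_bound(1)[OF coord]) (use elim d in auto)
      then show ?case
        by (intro filterlim_compose[OF infsum_tendsto filterlim_int_intervals])
    qed
  qed
  have N2: "integrable (lebesgue_on I) (\<lambda>\<theta>. (N (f \<theta>))\<^sup>2)"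
    using f by (simp add: L2_space_def)
  show ?thesis
    unfolding L2_pairing_def
  proof (rule integral_dominated_convergence)
    \<comment> \<open>\<open>1 + (N (f \<theta>))\<^sup>2\<close> bounds
      \<open>N (f \<theta>)\<close> and is integrable because \<open>I\<close> has finite
      measure.\<close>
    show "integrable (lebesgue_on I) (\<lambda>\<theta>. (1 + (N (f \<theta>))\<^sup>2) * \<bar>K\<bar>)"
      by (intro integrable_mult_left Bochner_Integration.integrable_add N2) simp
    show "(\<lambda>\<theta>. \<Sum>\<^sub>\<infinity>l. f \<theta> l * c \<theta> l) \<in> borel_measurable (lebesgue_on I)"
      by (rule pairing_meas) (auto intro: meas c)
    show "(\<lambda>\<theta>. \<Sum>\<^sub>\<infinity>l. f \<theta> l * b n \<theta> l) \<in> borel_measurable (lebesgue_on I)" for n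
      by (rule pairing_meas) (auto intro: meas b)
    show "AE \<theta> in lebesgue_on I. (\<lambda>n. \<Sum>\<^sub>\<infinity>l. f \<theta> l * b n \<theta> l) \<longlonglongrightarrow> (\<Sum>\<^sub>\<infinity>l. f \<theta> l * c \<theta> l)"
      using fX by eventually_elim (rule c0_pairing_tendsto[where K = K], use X b c lim in auto)
    show "AE \<theta> in lebesgue_on I. norm (\<Sum>\<^sub>\<infinity>l. f \<theta> l * b n \<theta> l) \<le> (1 + (N (f \<theta>))\<^sup>2) * \<bar>K\<bar>" for n
      using fX
    proof eventually_elim
      case (elim \<theta>)
      let ?N = "N (f \<theta>)"
      have "0 \<le> ?N"
        using coord[of "f \<theta>" 0] elim by linarith
      have "norm (\<Sum>\<^sub>\<infinity>l. f \<theta> l * b n \<theta> l) \<le> ?N * (\<Sum>\<^sub>\<infinity>l. b n \<theta> l)"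
        unfolding real_norm_def by (rule l1_pairing_bound(2)[OF coord]) (use elim b in auto)
      also have "\<dots> \<le> ?N * \<bar>K\<bar>"
        using \<open>0 \<le> ?N\<close> b(3)[of \<theta> n] elim by (intro mult_left_mono) auto
      also have "?N \<le> 1 + ?N\<^sup>2"
        using zero_le_power2[of "?N - 1/2"] by (simp add: power2_eq_square algebra_simps)
      then have "?N * \<bar>K\<bar> \<le> (1 + ?N\<^sup>2) * \<bar>K\<bar>"
        by (rule mult_right_mono) simp
      finally show ?case .
    qed
  qed
qed

section \<open>The forward operator\<close>

context orthonormal_basis
begin

text \<open>\<open>cadjoint U \<circ> U = id\<close> makes \<open>U\<close> an isometry.\<close>

lemma unitary_op_onorm_le:
  fixes U :: "'a \<Rightarrow> 'a"
  assumes "unitary_op U"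
  shows "onorm U \<le> 1"
proof (rule onorm_bound)
  fix x
  have U: "bounded_clinear U" and "cadjoint U (U x) = x"
    using assms by (auto simp: unitary_op_def fun_eq_iff)
  then have "cinner (U x) (U x) = cinner x x"
    by (metis cinner_cadjoint)
  then have "(norm (U x))\<^sup>2 = (norm x)\<^sup>2"
    by (simp only: cinner_self of_real_eq_iff)
  then show "norm (U x) \<le> 1 * norm x"
    by simp
qed simp

end

lemma forward_op_eq_quad_form:
  assumes "is_onb e" "bounded_clinear (U \<theta>)"
  shows "forward_op e U \<rho> \<theta> l = quad_form \<rho> (cadjoint (U \<theta>) (e l))"
proof -
  interpret orthonormal_basis e
    by unfold_locales fact
  show ?thesis
    by (simp add: forward_op_def quad_form_def cinner_cadjoint[OF assms(2)])
qed

lemma forward_op_weak_star_seq_continuous: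
  fixes e :: "int \<Rightarrow> 'a::chilbert_space" and U :: "real \<Rightarrow> 'a \<Rightarrow> 'a"
  assumes e: "is_onb e" and I: "bounded I" "I \<in> sets lebesgue" and p: "1 \<le> p"
    and U: "\<And>\<theta>. \<theta> \<in> I \<Longrightarrow> bounded_clinear (U \<theta>)" "\<And>\<theta>. \<theta> \<in> I \<Longrightarrow> onorm (U \<theta>) \<le> C"
    and T: "\<And>\<rho>. \<rho> \<in> pos_trace_class e \<Longrightarrow> forward_op e U \<rho> \<in> L2_lp I p"
  shows "weak_star_seq_continuous e I p (forward_op e U)"
  unfolding weak_star_seq_continuous_def weak_star_conv_L2_def
proof (intro allI impI ballI)
  interpret orthonormal_basis e
    by unfold_locales (rule e)
  fix \<rho>s \<rho> f
  assume \<rho>s: "\<forall>n. \<rho>s n \<in> pos_trace_class e" and \<rho>: "\<rho> \<in> pos_trace_class e"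
    and conv: "weak_star_conv_op e \<rho>s \<rho>" and f: "f \<in> L2_lp_predual I p"
  obtain S where S: "\<And>n. (\<Sum>\<^sub>\<infinity>l. quad_form (\<rho>s n) (e l)) \<le> S"
    using weak_star_conv_op_trace_bounded[OF spec[OF \<rho>s] conv] by blast
  \<comment> \<open>The maximum makes one constant bound the masses of the whole sequence and of the
    limit.\<close>
  define K where "K = C\<^sup>2 * max S (\<Sum>\<^sub>\<infinity>l. quad_form \<rho> (e l))"
  have Tq: "forward_op e U \<sigma> \<theta> = (\<lambda>l. quad_form \<sigma> (cadjoint (U \<theta>) (e l)))" if "\<theta> \<in> I" for \<sigma> \<theta>
    using forward_op_eq_quad_form[where U = U, OF e U(1)[OF that]] by blast
  have pos: "positive_op \<sigma>" if "\<sigma> \<in> pos_trace_class e" for \<sigma>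
    using that by (simp add: pos_trace_class_def)
  have T_nonneg: "0 \<le> forward_op e U \<sigma> \<theta> l" if "\<sigma> \<in> pos_trace_class e" "\<theta> \<in> I" for \<sigma> \<theta> l
    by (simp add: Tq that quad_form_nonneg pos)
  have T_summable: "forward_op e U \<sigma> \<theta> summable_on UNIV"
    if "\<sigma> \<in> pos_trace_class e" "\<theta> \<in> I" for \<sigma> \<theta>
    unfolding Tq[OF that(2)]
    by (rule quad_form_cadjoint_sum_le(1)[OF pos[OF that(1)] summable_quad_form[OF that(1)] U[OF that(2)]])
  have T_le: "(\<Sum>\<^sub>\<infinity>l. forward_op e U \<sigma> \<theta> l) \<le> C\<^sup>2 * (\<Sum>\<^sub>\<infinity>l. quad_form \<sigma> (e l))"
    if "\<sigma> \<in> pos_trace_class e" "\<theta> \<in> I" for \<sigma> \<theta>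
    unfolding Tq[OF that(2)]
    by (rule quad_form_cadjoint_sum_le(2)[OF pos[OF that(1)] summable_quad_form[OF that(1)] U[OF that(2)]])
  have T_le_K: "(\<Sum>\<^sub>\<infinity>l. forward_op e U (\<rho>s n) \<theta> l) \<le> K" "(\<Sum>\<^sub>\<infinity>l. forward_op e U \<rho> \<theta> l) \<le> K"
    if "\<theta> \<in> I" for n \<theta>
    unfolding K_def using S[of n] that \<rho>s \<rho>
    by (auto intro!: order_trans[OF T_le] mult_left_mono simp: le_max_iff_disj)
  \<comment> \<open>Measurability in \<open>\<theta>\<close> is extracted from the assumption that
    the forward operator maps into \<open>L2_lp I p\<close>.\<close>
  have T_meas: "(\<lambda>\<theta>. forward_op e U \<sigma> \<theta> l) \<in> borel_measurable (lebesgue_on I)"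
    if "\<sigma> \<in> pos_trace_class e" for \<sigma> l
    by (rule L2_space_coordinate_measurable[OF T[OF that] I(2) abs_le_lp_norm[OF _ p] lp_space_diff[OF _ _ p]])
  have T_lim: "(\<lambda>n. forward_op e U (\<rho>s n) \<theta> l) \<longlonglongrightarrow> forward_op e U \<rho> \<theta> l" if "\<theta> \<in> I" for \<theta> l
    unfolding Tq[OF that] using \<rho>s \<rho> conv by (intro weak_star_conv_op_quad_form pos) auto
  have lim: "(\<lambda>n. L2_pairing I f (forward_op e U (\<rho>s n))) \<longlonglongrightarrow> L2_pairing I f (forward_op e U \<rho>)"
    if "f \<in> L2_space I X N" "X \<subseteq> c0_space" "\<And>a l. a \<in> X \<Longrightarrow> \<bar>a l\<bar> \<le> N a"
      "\<And>a b. a \<in> X \<Longrightarrow> b \<in> X \<Longrightarrow> (\<lambda>l. a l - b l) \<in> X" for X N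
    by (rule L2_pairing_tendsto[where K = K, OF that(1) I(2,1) that(2-4)])
      (use \<rho>s \<rho> in \<open>simp_all add: T_meas T_nonneg T_summable T_le_K T_lim\<close>)
  show "(\<lambda>n. L2_pairing I f (forward_op e U (\<rho>s n))) \<longlonglongrightarrow> L2_pairing I f (forward_op e U \<rho>)"
  proof (cases "p = 1")
    case True
    then show ?thesis
      using f by (intro lim[of c0_space sup_norm] abs_le_sup_norm c0_space_diff)
        (simp_all add: L2_lp_predual_def)
  next
    case False
    then have q: "1 \<le> p / (p - 1)"
      using p by (simp add: field_simps)
    show ?thesis
    proof (rule lim[OF _ lp_space_subset_c0[OF q] abs_le_lp_norm[OF _ q] lp_space_diff[OF _ _ q]])
      show "f \<in> L2_lp I (p / (p - 1))"
        using f False by (simp add: L2_lp_predual_def)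
    qed
  qed
qed

theorem lemma2p12:
  fixes e :: "int \<Rightarrow> 'a::chilbert_space"
    and I :: "real set"
    and p :: real
    and U :: "real \<Rightarrow> 'a \<Rightarrow> 'a"
  assumes "is_onb e"
    and "bounded I" and "I \<in> sets lebesgue"
    and "1 \<le> p"
    and "\<And>\<theta>. \<theta> \<in> I \<Longrightarrow> bounded_clinear (U \<theta>)"
    and "\<And>\<rho>. \<rho> \<in> pos_trace_class e \<Longrightarrow> forward_op e U \<rho> \<in> L2_lp I p"
  shows "((\<exists>C. \<forall>\<theta>\<in>I. onorm (U \<theta>) \<le> C) \<longrightarrow> weak_star_seq_continuous e I p (forward_op e U)) \<and>
         ((\<forall>\<theta>\<in>I. unitary_op (U \<theta>)) \<longrightarrow> weak_star_seq_continuous e I p (forward_op e U))"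
proof -
  have uniform: "weak_star_seq_continuous e I p (forward_op e U)"
    if "\<And>\<theta>. \<theta> \<in> I \<Longrightarrow> onorm (U \<theta>) \<le> C" for C
    using assms(1-5) that assms(6) by (rule forward_op_weak_star_seq_continuous)
  interpret orthonormal_basis e
    by unfold_locales (rule assms(1))
  show ?thesis
    \<comment> \<open>The unitary case is the uniform one with bound 1.\<close>
    using uniform unitary_op_onorm_le by blast
qed

end
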